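(* Let $X$ be a commutative monoid and $K$ a commutative ring. The category of covariant functors $L_X\to\mathbf{Mod}_K$ is canonically equivalent to the category of (left) $\widetilde{K}X$-modules. The category of contravariant functors $L_X\to\mathbf{Mod}_K$ is canonically equivalent to the category of right $\widetilde{K}X$-modules.
   Context: Commutative monoids are written additively. The Leech category $L_X$ has object set $X$, morphisms $L_X(x,z)=\{y\in X:x+y=z\}$, and identities and composition given by the zero element and addition of $X$. $\mathbf{Mod}_K$ is the category of $K$-modules. An $X$-graded $K$-module is a family $(V_x)_{x\in X}$ of $K$-modules; the graded tensor product is $(V\otimes_K W)_z=\bigoplus_{x+y=z}V_x\otimes_K W_y$, with unit $K$ concentrated in degree $0$. An $X$-graded $K$-algebra is a monoid for this tensor product. A left module over an $X$-graded $K$-algebra $A$ is an $X$-graded $K$-module $N$ with a (unital, associative) left action $A_y\otimes_K N_x\to N_{x+y}$. A right $A$-module is a family $(M^x)_{x\in X}$ of $K$-modules together with homomorphisms $\varphi_{x,y}:M^{x+y}\otimes_K A_y\to M^x$ such that $\varphi_{x,0}(m\otimes1)=m$ and $\varphi_{x,y}(\varphi_{x+y,z}(m\otimes a)\otimes b)=\varphi_{x,y+z}(m\otimes ab)$ for $m\in M^{x+y+z}$, $a\in A_z$, $b\in A_y$. (This is not a right action in the naive degree-adding sense.) Morphisms are degreewise $K$-linear maps compatible with the structure. $\widetilde{K}X$ is the commutative $X$-graded $K$-algebra in which $(\widetilde{K}X)_x$ is the free $K$-module on one generator $1_x$, with unit $1_0$ and multiplication $1_x1_y=1_{x+y}$.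 *)

theory Defs
  imports "HOL-Algebra.Module" "HOL-Algebra.AbelCoset"
begin

section \<open>Categories, functors and equivalences\<close>

text \<open>
  Hom-sets are indexed by source and target and need not be disjoint, so composition and the
  arrow part of a functor take the objects involved as arguments: \<open>cmp C a b c g f\<close> is the
  composite of \<open>f : a \<rightarrow> b\<close> followed by \<open>g : b \<rightarrow> c\<close>. In the Leech category, for instance,
  one and the same element of the monoid is an arrow out of every object.
\<close>

record ('o, 'a) cat =
  obj :: "'o set"
  arr :: "'o \<Rightarrow> 'o \<Rightarrow> 'a set"
  ide :: "'o \<Rightarrow> 'a"
  cmp :: "'o \<Rightarrow> 'o \<Rightarrow> 'o \<Rightarrow> 'a \<Rightarrow> 'a \<Rightarrow> 'a"

locale category =
  fixes C :: "('o, 'a) cat"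
  assumes ide_closed: "a \<in> obj C \<Longrightarrow> ide C a \<in> arr C a a"
    and cmp_closed: "\<lbrakk>a \<in> obj C; b \<in> obj C; c \<in> obj C; f \<in> arr C a b; g \<in> arr C b c\<rbrakk>
      \<Longrightarrow> cmp C a b c g f \<in> arr C a c"
    and cmp_ide_left: "\<lbrakk>a \<in> obj C; b \<in> obj C; f \<in> arr C a b\<rbrakk>
      \<Longrightarrow> cmp C a b b (ide C b) f = f"
    and cmp_ide_right: "\<lbrakk>a \<in> obj C; b \<in> obj C; f \<in> arr C a b\<rbrakk>
      \<Longrightarrow> cmp C a a b f (ide C a) = f"
    and cmp_assoc: "\<lbrakk>a \<in> obj C; b \<in> obj C; c \<in> obj C; d \<in> obj C;
        f \<in> arr C a b; g \<in> arr C b c; h \<in> arr C c d\<rbrakk>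
      \<Longrightarrow> cmp C a c d h (cmp C a b c g f) = cmp C a b d (cmp C b c d h g) f"

definition op_cat :: "('o, 'a) cat \<Rightarrow> ('o, 'a) cat" where
  "op_cat C = \<lparr>obj = obj C, arr = (\<lambda>a b. arr C b a), ide = ide C,
     cmp = (\<lambda>a b c g f. cmp C c b a f g)\<rparr>"

record ('o, 'a, 'p, 'b) cfunctor =
  omap :: "'o \<Rightarrow> 'p"
  amap :: "'o \<Rightarrow> 'o \<Rightarrow> 'a \<Rightarrow> 'b"

locale cat_functor = C: category C + D: category D
  for C :: "('o, 'a) cat" and D :: "('p, 'b) cat" +
  fixes F :: "('o, 'a, 'p, 'b) cfunctor"
  assumes omap_closed: "a \<in> obj C \<Longrightarrow> omap F a \<in> obj D"
    and amap_closed: "\<lbrakk>a \<in> obj C; b \<in> obj C; f \<in> arr C a b\<rbrakk>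
      \<Longrightarrow> amap F a b f \<in> arr D (omap F a) (omap F b)"
    and amap_ide: "a \<in> obj C \<Longrightarrow> amap F a a (ide C a) = ide D (omap F a)"
    and amap_cmp: "\<lbrakk>a \<in> obj C; b \<in> obj C; c \<in> obj C; f \<in> arr C a b; g \<in> arr C b c\<rbrakk>
      \<Longrightarrow> amap F a c (cmp C a b c g f)
        = cmp D (omap F a) (omap F b) (omap F c) (amap F b c g) (amap F a b f)"

definition id_functor :: "('o, 'a, 'o, 'a) cfunctor" where
  "id_functor = \<lparr>omap = (\<lambda>a. a), amap = (\<lambda>a b f. f)\<rparr>"

definition comp_functor ::
  "('p, 'b, 'q, 'c) cfunctor \<Rightarrow> ('o, 'a, 'p, 'b) cfunctor \<Rightarrow> ('o, 'a, 'q, 'c) cfunctor" where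
  "comp_functor G F = \<lparr>omap = (\<lambda>a. omap G (omap F a)),
     amap = (\<lambda>a b f. amap G (omap F a) (omap F b) (amap F a b f))\<rparr>"

text \<open>
  Natural transformations are extensional families, so that they are equal as soon as their
  components are.
\<close>

definition nat_trans ::
  "('o, 'a) cat \<Rightarrow> ('p, 'b) cat \<Rightarrow> ('o, 'a, 'p, 'b) cfunctor \<Rightarrow> ('o, 'a, 'p, 'b) cfunctor
    \<Rightarrow> ('o \<Rightarrow> 'b) set" where
  "nat_trans C D F G = {\<tau> \<in> (\<Pi>\<^sub>E a\<in>obj C. arr D (omap F a) (omap G a)).
     \<forall>a\<in>obj C. \<forall>b\<in>obj C. \<forall>f\<in>arr C a b.
       cmp D (omap F a) (omap F b) (omap G b) (\<tau> b) (amap F a b f)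
       = cmp D (omap F a) (omap G a) (omap G b) (amap G a b f) (\<tau> a)}"

definition functor_cat ::
  "('o, 'a) cat \<Rightarrow> ('p, 'b) cat \<Rightarrow> (('o, 'a, 'p, 'b) cfunctor, 'o \<Rightarrow> 'b) cat" where
  "functor_cat C D = \<lparr>obj = {F. cat_functor C D F}, arr = nat_trans C D,
     ide = (\<lambda>F. \<lambda>a\<in>obj C. ide D (omap F a)),
     cmp = (\<lambda>F G H \<tau> \<sigma>. \<lambda>a\<in>obj C. cmp D (omap F a) (omap G a) (omap H a) (\<tau> a) (\<sigma> a))\<rparr>"

definition isomorphic_in :: "('o, 'a) cat \<Rightarrow> 'o \<Rightarrow> 'o \<Rightarrow> bool" where
  "isomorphic_in C a b \<longleftrightarrow> a \<in> obj C \<and> b \<in> obj C \<and>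
     (\<exists>f\<in>arr C a b. \<exists>g\<in>arr C b a. cmp C a b a g f = ide C a \<and> cmp C b a b f g = ide C b)"

text \<open>The functor \<open>F\<close> is an equivalence: it has a quasi-inverse up to natural isomorphism.\<close>

definition equivalence_of_categories ::
  "('o, 'a) cat \<Rightarrow> ('p, 'b) cat \<Rightarrow> ('o, 'a, 'p, 'b) cfunctor \<Rightarrow> bool" where
  "equivalence_of_categories C D F \<longleftrightarrow> cat_functor C D F \<and>
     (\<exists>G. cat_functor D C G \<and>
       isomorphic_in (functor_cat C C) id_functor (comp_functor G F) \<and>
       isomorphic_in (functor_cat D D) (comp_functor F G) id_functor)"


section \<open>The Leech category\<close>

text \<open>Addition in the monoid \<open>X\<close> is the operation written \<open>\<otimes>\<^bsub>X\<^esub>\<close>, with neutral element \<open>\<one>\<^bsub>X\<^esub>\<close>.\<close>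

definition leech :: "('x, 's) monoid_scheme \<Rightarrow> ('x, 'x) cat" where
  "leech X = \<lparr>obj = carrier X, arr = (\<lambda>x z. {y \<in> carrier X. x \<otimes>\<^bsub>X\<^esub> y = z}),
     ide = (\<lambda>x. \<one>\<^bsub>X\<^esub>), cmp = (\<lambda>x y z g f. f \<otimes>\<^bsub>X\<^esub> g)\<rparr>"


section \<open>Modules and their tensor product\<close>

text \<open>Linear maps are extensional on the carrier of their domain.\<close>

definition lin_maps ::
  "('k, 'r) ring_scheme \<Rightarrow> ('k, 'm) module \<Rightarrow> ('k, 'n) module \<Rightarrow> ('m \<Rightarrow> 'n) set" where
  "lin_maps K M N = {f \<in> carrier M \<rightarrow>\<^sub>E carrier N.
     (\<forall>u\<in>carrier M. \<forall>v\<in>carrier M. f (u \<oplus>\<^bsub>M\<^esub> v) = f u \<oplus>\<^bsub>N\<^esub> f v) \<and>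
     (\<forall>k\<in>carrier K. \<forall>v\<in>carrier M. f (k \<odot>\<^bsub>M\<^esub> v) = k \<odot>\<^bsub>N\<^esub> f v)}"

text \<open>
  HOL has no universe of all types: \<open>mod_cat K\<close> consists of the \<open>K\<close>-modules carried by subsets
  of an arbitrary type \<open>'v\<close>. Module records also contain the ring fields \<open>mult\<close> and \<open>one\<close>, which
  have no meaning for a module; records that differ only there, or outside the carrier, are
  distinct but isomorphic objects.
\<close>

definition mod_cat :: "('k, 'r) ring_scheme \<Rightarrow> (('k, 'v) module, 'v \<Rightarrow> 'v) cat" where
  "mod_cat K = \<lparr>obj = {M. module K M}, arr = lin_maps K, ide = (\<lambda>M. \<lambda>v\<in>carrier M. v),
     cmp = (\<lambda>M N P g f. compose (carrier M) g f)\<rparr>"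

definition free_module :: "('k, 'r) ring_scheme \<Rightarrow> 's set \<Rightarrow> ('k, 's \<Rightarrow> 'k) module" where
  "free_module K S =
    \<lparr>carrier = {f. (\<forall>s. f s \<in> carrier K) \<and> (\<forall>s. s \<notin> S \<longrightarrow> f s = \<zero>\<^bsub>K\<^esub>) \<and> finite {s. f s \<noteq> \<zero>\<^bsub>K\<^esub>}},
     mult = undefined, one = undefined,
     zero = (\<lambda>s. \<zero>\<^bsub>K\<^esub>), add = (\<lambda>f g s. f s \<oplus>\<^bsub>K\<^esub> g s),
     smult = (\<lambda>k f s. k \<otimes>\<^bsub>K\<^esub> f s)\<rparr>"

definition free_gen :: "('k, 'r) ring_scheme \<Rightarrow> 's \<Rightarrow> ('s \<Rightarrow> 'k)" where
  "free_gen K s = (\<lambda>t. if t = s then \<one>\<^bsub>K\<^esub> else \<zero>\<^bsub>K\<^esub>)"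

definition submodule_span ::
  "('k, 'r) ring_scheme \<Rightarrow> ('k, 'm) module \<Rightarrow> 'm set \<Rightarrow> 'm set" where
  "submodule_span K M S = \<Inter>{H. submodule H K M \<and> S \<subseteq> H}"

definition quotient_module ::
  "('k, 'm) module \<Rightarrow> 'm set \<Rightarrow> ('k, 'm set) module" where
  "quotient_module M H =
    \<lparr>carrier = a_rcosets\<^bsub>M\<^esub> H, mult = undefined, one = undefined,
     zero = H, add = (\<lambda>U V. U <+>\<^bsub>M\<^esub> V),
     smult = (\<lambda>k U. \<Union>u\<in>U. H +>\<^bsub>M\<^esub> (k \<odot>\<^bsub>M\<^esub> u))\<rparr>"

abbreviation pair_module ::
  "('k, 'r) ring_scheme \<Rightarrow> ('k, 'm) module \<Rightarrow> ('k, 'n) module \<Rightarrow> ('k, 'm \<times> 'n \<Rightarrow> 'k) module" where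
  "pair_module K M N \<equiv> free_module K (carrier M \<times> carrier N)"

definition tensor_rels ::
  "('k, 'r) ring_scheme \<Rightarrow> ('k, 'm) module \<Rightarrow> ('k, 'n) module \<Rightarrow> ('m \<times> 'n \<Rightarrow> 'k) set" where
  "tensor_rels K M N =
     {free_gen K (u \<oplus>\<^bsub>M\<^esub> v, w) \<ominus>\<^bsub>pair_module K M N\<^esub>
        (free_gen K (u, w) \<oplus>\<^bsub>pair_module K M N\<^esub> free_gen K (v, w))
       | u v w. u \<in> carrier M \<and> v \<in> carrier M \<and> w \<in> carrier N} \<union>
     {free_gen K (u, v \<oplus>\<^bsub>N\<^esub> w) \<ominus>\<^bsub>pair_module K M N\<^esub>
        (free_gen K (u, v) \<oplus>\<^bsub>pair_module K M N\<^esub> free_gen K (u, w))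
       | u v w. u \<in> carrier M \<and> v \<in> carrier N \<and> w \<in> carrier N} \<union>
     {free_gen K (k \<odot>\<^bsub>M\<^esub> u, w) \<ominus>\<^bsub>pair_module K M N\<^esub>
        (k \<odot>\<^bsub>pair_module K M N\<^esub> free_gen K (u, w))
       | k u w. k \<in> carrier K \<and> u \<in> carrier M \<and> w \<in> carrier N} \<union>
     {free_gen K (u, k \<odot>\<^bsub>N\<^esub> w) \<ominus>\<^bsub>pair_module K M N\<^esub>
        (k \<odot>\<^bsub>pair_module K M N\<^esub> free_gen K (u, w))
       | k u w. k \<in> carrier K \<and> u \<in> carrier M \<and> w \<in> carrier N}"

definition tensor_kernel ::
  "('k, 'r) ring_scheme \<Rightarrow> ('k, 'm) module \<Rightarrow> ('k, 'n) module \<Rightarrow> ('m \<times> 'n \<Rightarrow> 'k) set" where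
  "tensor_kernel K M N = submodule_span K (pair_module K M N) (tensor_rels K M N)"

definition tensor ::
  "('k, 'r) ring_scheme \<Rightarrow> ('k, 'm) module \<Rightarrow> ('k, 'n) module
    \<Rightarrow> ('k, ('m \<times> 'n \<Rightarrow> 'k) set) module" where
  "tensor K M N = quotient_module (pair_module K M N) (tensor_kernel K M N)"

definition tens ::
  "('k, 'r) ring_scheme \<Rightarrow> ('k, 'm) module \<Rightarrow> ('k, 'n) module \<Rightarrow> 'm \<Rightarrow> 'n
    \<Rightarrow> ('m \<times> 'n \<Rightarrow> 'k) set" where
  "tens K M N u v = tensor_kernel K M N +>\<^bsub>pair_module K M N\<^esub> free_gen K (u, v)"


section \<open>Graded algebras and their modules\<close>

text \<open>
  A degree-preserving linear map out of the graded tensor product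
  \<open>(V \<otimes> W)\<^sub>z = \<Oplus>\<^bsub>x+y=z\<^esub> V\<^sub>x \<otimes> W\<^sub>y\<close> is given by its restrictions to the summands
  \<open>V\<^sub>x \<otimes> W\<^sub>y\<close>. Multiplications and actions are recorded through these components, and the unit map
  from \<open>K\<close>, placed in degree zero, through the image of \<open>\<one>\<^bsub>K\<^esub>\<close>. The identities between linear
  maps out of iterated tensor products are stated on elementary tensors.
\<close>

record ('x, 'k, 'a) galg =
  gcomp :: "'x \<Rightarrow> ('k, 'a) module"
  gmul :: "'x \<Rightarrow> 'x \<Rightarrow> ('a \<times> 'a \<Rightarrow> 'k) set \<Rightarrow> 'a"
  gone :: 'a

locale graded_algebra = X: comm_monoid X + K: cring K
  for X :: "('x, 's) monoid_scheme" and K :: "('k, 'r) ring_scheme" +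
  fixes A :: "('x, 'k, 'a) galg"
  assumes gcomp_module: "x \<in> carrier X \<Longrightarrow> module K (gcomp A x)"
    and gmul_linear: "\<lbrakk>x \<in> carrier X; y \<in> carrier X\<rbrakk>
      \<Longrightarrow> gmul A x y \<in> lin_maps K (tensor K (gcomp A x) (gcomp A y)) (gcomp A (x \<otimes>\<^bsub>X\<^esub> y))"
    and gone_closed: "gone A \<in> carrier (gcomp A \<one>\<^bsub>X\<^esub>)"
    and gone_left: "\<lbrakk>x \<in> carrier X; a \<in> carrier (gcomp A x)\<rbrakk>
      \<Longrightarrow> gmul A \<one>\<^bsub>X\<^esub> x (tens K (gcomp A \<one>\<^bsub>X\<^esub>) (gcomp A x) (gone A) a) = a"
    and gone_right: "\<lbrakk>x \<in> carrier X; a \<in> carrier (gcomp A x)\<rbrakk>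
      \<Longrightarrow> gmul A x \<one>\<^bsub>X\<^esub> (tens K (gcomp A x) (gcomp A \<one>\<^bsub>X\<^esub>) a (gone A)) = a"
    and gmul_assoc: "\<lbrakk>x \<in> carrier X; y \<in> carrier X; z \<in> carrier X;
        a \<in> carrier (gcomp A x); b \<in> carrier (gcomp A y); c \<in> carrier (gcomp A z)\<rbrakk>
      \<Longrightarrow> gmul A (x \<otimes>\<^bsub>X\<^esub> y) z (tens K (gcomp A (x \<otimes>\<^bsub>X\<^esub> y)) (gcomp A z)
            (gmul A x y (tens K (gcomp A x) (gcomp A y) a b)) c)
        = gmul A x (y \<otimes>\<^bsub>X\<^esub> z) (tens K (gcomp A x) (gcomp A (y \<otimes>\<^bsub>X\<^esub> z))
            a (gmul A y z (tens K (gcomp A y) (gcomp A z) b c)))"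

text \<open>
  \<open>lact N y x\<close> is the action \<open>A\<^sub>y \<otimes> N\<^sub>x \<rightarrow> N\<^bsub>x+y\<^esub>\<close>.
\<close>

record ('x, 'k, 'a, 'v) lmod =
  lcomp :: "'x \<Rightarrow> ('k, 'v) module"
  lact :: "'x \<Rightarrow> 'x \<Rightarrow> ('a \<times> 'v \<Rightarrow> 'k) set \<Rightarrow> 'v"

locale left_module = graded_algebra X K A
  for X :: "('x, 's) monoid_scheme" and K :: "('k, 'r) ring_scheme"
    and A :: "('x, 'k, 'a) galg" +
  fixes N :: "('x, 'k, 'a, 'v) lmod"
  assumes lcomp_module: "x \<in> carrier X \<Longrightarrow> module K (lcomp N x)"
    and lact_linear: "\<lbrakk>x \<in> carrier X; y \<in> carrier X\<rbrakk>
      \<Longrightarrow> lact N y x \<in> lin_maps K (tensor K (gcomp A y) (lcomp N x)) (lcomp N (x \<otimes>\<^bsub>X\<^esub> y))"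
    and lact_one: "\<lbrakk>x \<in> carrier X; n \<in> carrier (lcomp N x)\<rbrakk>
      \<Longrightarrow> lact N \<one>\<^bsub>X\<^esub> x (tens K (gcomp A \<one>\<^bsub>X\<^esub>) (lcomp N x) (gone A) n) = n"
    and lact_assoc: "\<lbrakk>x \<in> carrier X; y \<in> carrier X; z \<in> carrier X;
        n \<in> carrier (lcomp N x); a \<in> carrier (gcomp A z); b \<in> carrier (gcomp A y)\<rbrakk>
      \<Longrightarrow> lact N z (x \<otimes>\<^bsub>X\<^esub> y) (tens K (gcomp A z) (lcomp N (x \<otimes>\<^bsub>X\<^esub> y))
            a (lact N y x (tens K (gcomp A y) (lcomp N x) b n)))
        = lact N (z \<otimes>\<^bsub>X\<^esub> y) x (tens K (gcomp A (z \<otimes>\<^bsub>X\<^esub> y)) (lcomp N x)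
            (gmul A z y (tens K (gcomp A z) (gcomp A y) a b)) n)"

definition lmod_maps ::
  "('x, 's) monoid_scheme \<Rightarrow> ('k, 'r) ring_scheme \<Rightarrow> ('x, 'k, 'a) galg
    \<Rightarrow> ('x, 'k, 'a, 'v) lmod \<Rightarrow> ('x, 'k, 'a, 'v) lmod \<Rightarrow> ('x \<Rightarrow> 'v \<Rightarrow> 'v) set" where
  "lmod_maps X K A N N' = {f \<in> (\<Pi>\<^sub>E x\<in>carrier X. lin_maps K (lcomp N x) (lcomp N' x)).
     \<forall>x\<in>carrier X. \<forall>y\<in>carrier X. \<forall>a\<in>carrier (gcomp A y). \<forall>n\<in>carrier (lcomp N x).
       f (x \<otimes>\<^bsub>X\<^esub> y) (lact N y x (tens K (gcomp A y) (lcomp N x) a n))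
       = lact N' y x (tens K (gcomp A y) (lcomp N' x) a (f x n))}"

definition lmod_cat ::
  "('x, 's) monoid_scheme \<Rightarrow> ('k, 'r) ring_scheme \<Rightarrow> ('x, 'k, 'a) galg
    \<Rightarrow> (('x, 'k, 'a, 'v) lmod, 'x \<Rightarrow> 'v \<Rightarrow> 'v) cat" where
  "lmod_cat X K A = \<lparr>obj = {N. left_module X K A N}, arr = lmod_maps X K A,
     ide = (\<lambda>N. \<lambda>x\<in>carrier X. \<lambda>v\<in>carrier (lcomp N x). v),
     cmp = (\<lambda>N N' N'' g f. \<lambda>x\<in>carrier X. compose (carrier (lcomp N x)) (g x) (f x))\<rparr>"

text \<open>
  \<open>ract M x y\<close> is the structure map \<open>\<phi>\<^bsub>x,y\<^esub> : M\<^bsup>x+y\<^esup> \<otimes> A\<^sub>y \<rightarrow> M\<^bsup>x\<^esup>\<close>, which lowers degrees.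
\<close>

record ('x, 'k, 'a, 'v) rmod =
  rcomp :: "'x \<Rightarrow> ('k, 'v) module"
  ract :: "'x \<Rightarrow> 'x \<Rightarrow> ('v \<times> 'a \<Rightarrow> 'k) set \<Rightarrow> 'v"

locale right_module = graded_algebra X K A
  for X :: "('x, 's) monoid_scheme" and K :: "('k, 'r) ring_scheme"
    and A :: "('x, 'k, 'a) galg" +
  fixes M :: "('x, 'k, 'a, 'v) rmod"
  assumes rcomp_module: "x \<in> carrier X \<Longrightarrow> module K (rcomp M x)"
    and ract_linear: "\<lbrakk>x \<in> carrier X; y \<in> carrier X\<rbrakk>
      \<Longrightarrow> ract M x y \<in> lin_maps K (tensor K (rcomp M (x \<otimes>\<^bsub>X\<^esub> y)) (gcomp A y)) (rcomp M x)"
    and ract_one: "\<lbrakk>x \<in> carrier X; m \<in> carrier (rcomp M x)\<rbrakk>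
      \<Longrightarrow> ract M x \<one>\<^bsub>X\<^esub> (tens K (rcomp M x) (gcomp A \<one>\<^bsub>X\<^esub>) m (gone A)) = m"
    and ract_assoc: "\<lbrakk>x \<in> carrier X; y \<in> carrier X; z \<in> carrier X;
        m \<in> carrier (rcomp M (x \<otimes>\<^bsub>X\<^esub> y \<otimes>\<^bsub>X\<^esub> z)); a \<in> carrier (gcomp A z); b \<in> carrier (gcomp A y)\<rbrakk>
      \<Longrightarrow> ract M x y (tens K (rcomp M (x \<otimes>\<^bsub>X\<^esub> y)) (gcomp A y)
            (ract M (x \<otimes>\<^bsub>X\<^esub> y) z (tens K (rcomp M (x \<otimes>\<^bsub>X\<^esub> y \<otimes>\<^bsub>X\<^esub> z)) (gcomp A z) m a)) b)
        = ract M x (y \<otimes>\<^bsub>X\<^esub> z) (tens K (rcomp M (x \<otimes>\<^bsub>X\<^esub> y \<otimes>\<^bsub>X\<^esub> z)) (gcomp A (y \<otimes>\<^bsub>X\<^esub> z))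
            m (gmul A z y (tens K (gcomp A z) (gcomp A y) a b)))"

definition rmod_maps ::
  "('x, 's) monoid_scheme \<Rightarrow> ('k, 'r) ring_scheme \<Rightarrow> ('x, 'k, 'a) galg
    \<Rightarrow> ('x, 'k, 'a, 'v) rmod \<Rightarrow> ('x, 'k, 'a, 'v) rmod \<Rightarrow> ('x \<Rightarrow> 'v \<Rightarrow> 'v) set" where
  "rmod_maps X K A M M' = {f \<in> (\<Pi>\<^sub>E x\<in>carrier X. lin_maps K (rcomp M x) (rcomp M' x)).
     \<forall>x\<in>carrier X. \<forall>y\<in>carrier X. \<forall>m\<in>carrier (rcomp M (x \<otimes>\<^bsub>X\<^esub> y)). \<forall>a\<in>carrier (gcomp A y).
       f x (ract M x y (tens K (rcomp M (x \<otimes>\<^bsub>X\<^esub> y)) (gcomp A y) m a))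
       = ract M' x y (tens K (rcomp M' (x \<otimes>\<^bsub>X\<^esub> y)) (gcomp A y) (f (x \<otimes>\<^bsub>X\<^esub> y) m) a)}"

definition rmod_cat ::
  "('x, 's) monoid_scheme \<Rightarrow> ('k, 'r) ring_scheme \<Rightarrow> ('x, 'k, 'a) galg
    \<Rightarrow> (('x, 'k, 'a, 'v) rmod, 'x \<Rightarrow> 'v \<Rightarrow> 'v) cat" where
  "rmod_cat X K A = \<lparr>obj = {M. right_module X K A M}, arr = rmod_maps X K A,
     ide = (\<lambda>M. \<lambda>x\<in>carrier X. \<lambda>v\<in>carrier (rcomp M x). v),
     cmp = (\<lambda>M M' M'' g f. \<lambda>x\<in>carrier X. compose (carrier (rcomp M x)) (g x) (f x))\<rparr>"


section \<open>The algebra $\widetilde{K}X$ and the canonical functors\<close>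

text \<open>
  The generator \<open>1\<^sub>x\<close> is \<open>free_gen K x\<close>; the multiplication is the linear map determined by
  \<open>1\<^sub>x \<otimes> 1\<^sub>y \<mapsto> 1\<^bsub>x+y\<^esub>\<close>.
\<close>

definition KX ::
  "('x, 's) monoid_scheme \<Rightarrow> ('k, 'r) ring_scheme \<Rightarrow> ('x, 'k, 'x \<Rightarrow> 'k) galg" where
  "KX X K = \<lparr>gcomp = (\<lambda>x. free_module K {x}),
     gmul = (\<lambda>x y. THE h.
       h \<in> lin_maps K (tensor K (free_module K {x}) (free_module K {y}))
             (free_module K {x \<otimes>\<^bsub>X\<^esub> y}) \<and>
       h (tens K (free_module K {x}) (free_module K {y}) (free_gen K x) (free_gen K y))
         = free_gen K (x \<otimes>\<^bsub>X\<^esub> y)),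
     gone = free_gen K \<one>\<^bsub>X\<^esub>\<rparr>"

text \<open>
  The canonical functors send a module to the functor with the same components, on which the arrow
  \<open>y\<close> between \<open>x\<close> and \<open>x + y\<close> acts as multiplication by \<open>1\<^sub>y\<close>. Contravariant functors are functors
  on the opposite category, so in the second case \<open>y\<close> is an arrow from \<open>z = x + y\<close> to \<open>x\<close>. A natural
  transformation and a morphism of graded modules are both families indexed by \<open>carrier X\<close>.
\<close>

definition left_canonical ::
  "('x, 's) monoid_scheme \<Rightarrow> ('k, 'r) ring_scheme
    \<Rightarrow> (('x, 'k, 'x \<Rightarrow> 'k, 'v) lmod, 'x \<Rightarrow> 'v \<Rightarrow> 'v,
        ('x, 'x, ('k, 'v) module, 'v \<Rightarrow> 'v) cfunctor, 'x \<Rightarrow> 'v \<Rightarrow> 'v) cfunctor" where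
  "left_canonical X K = \<lparr>omap = (\<lambda>N. \<lparr>omap = lcomp N,
       amap = (\<lambda>x z y. \<lambda>n\<in>carrier (lcomp N x).
         lact N y x (tens K (gcomp (KX X K) y) (lcomp N x) (free_gen K y) n))\<rparr>),
     amap = (\<lambda>N N' f. f)\<rparr>"

definition right_canonical ::
  "('x, 's) monoid_scheme \<Rightarrow> ('k, 'r) ring_scheme
    \<Rightarrow> (('x, 'k, 'x \<Rightarrow> 'k, 'v) rmod, 'x \<Rightarrow> 'v \<Rightarrow> 'v,
        ('x, 'x, ('k, 'v) module, 'v \<Rightarrow> 'v) cfunctor, 'x \<Rightarrow> 'v \<Rightarrow> 'v) cfunctor" where
  "right_canonical X K = \<lparr>omap = (\<lambda>M. \<lparr>omap = rcomp M,
       amap = (\<lambda>z x y. \<lambda>m\<in>carrier (rcomp M z).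
         ract M x y (tens K (rcomp M z) (gcomp (KX X K) y) m (free_gen K y)))\<rparr>),
     amap = (\<lambda>M M' f. f)\<rparr>"

end

theory Submission
  imports Defs
begin

text \<open>
  Both equivalences rest on one observation: the structure maps of an action of \<open>KX\<close> on \<open>N\<close> amount to
  linear maps \<open>N\<^sub>x \<rightarrow> N\<^bsub>x+y\<^esub>\<close>, one for each pair \<open>(x, y)\<close>. Indeed the degree \<open>y\<close> part of the algebra is free of
  rank one on \<open>1\<^sub>y\<close>, so a linear map out of \<open>(KX)\<^sub>y \<otimes> N\<^sub>x\<close> is determined by its values on the
  tensors \<open>1\<^sub>y \<otimes> n\<close>, and these values may be any linear function \<open>\<phi>\<close> of \<open>n\<close>; the map is then
  \<open>a \<otimes> n \<mapsto> a(y) \<cdot> \<phi>(n)\<close>, where \<open>a(y)\<close> is the coefficient of \<open>1\<^sub>y\<close> in \<open>a\<close>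
  (\<open>tensor_free_left_hom\<close>, \<open>tensor_free_left_lift\<close> and their mirror images).

  Under this dictionary the action of \<open>1\<^sub>y\<close> on \<open>N\<^sub>x\<close> becomes the value of a functor on the arrow
  \<open>y : x \<rightarrow> x + y\<close>. Unitality of the action is preservation of identities. Since
  \<open>1\<^sub>z 1\<^sub>y = 1\<^bsub>z+y\<^esub>\<close>, associativity is preservation of composites; the order of the factors is
  harmless because \<open>X\<close> is commutative. Compatibility of a family of linear maps with the actions can
  be tested on generators, where it is naturality. For right modules the structure maps
  \<open>M\<^bsup>x+y\<^esup> \<otimes> (KX)\<^sub>y \<rightarrow> M\<^bsup>x\<^esup>\<close> go from the target of the arrow \<open>y\<close> to its source, which yields
  contravariant functors in the same way.

  Consequently the canonical functors are the identity on hom-sets (\<open>lmod_maps_eq_nat_trans\<close>,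
  \<open>rmod_maps_eq_nat_trans\<close>), and every functor is isomorphic to one in their image
  (\<open>functor_to_left_module\<close>, \<open>functor_to_right_module\<close>). A functor of this kind is an equivalence
  by \<open>equivalence_by_hom_identification\<close>. The dictionary itself comes from the universal property
  \<open>tensor_lift\<close> of the tensor product, constructed as a quotient of a free module.
\<close>

section \<open>Equivalences of categories\<close>

lemma op_cat_simps:
  "obj (op_cat C) = obj C"
  "arr (op_cat C) a b = arr C b a"
  "ide (op_cat C) = ide C"
  "cmp (op_cat C) a b c g f = cmp C c b a f g"
  by (simp_all add: op_cat_def)

lemma category_op_cat:
  assumes "category C"
  shows "category (op_cat C)"
proof -
  interpret C: category C by fact
  show ?thesis
    by unfold_locales
      (simp_all add: op_cat_simps C.ide_closed C.cmp_closed C.cmp_ide_left C.cmp_ide_right C.cmp_assoc)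
qed

lemma nat_transI:
  assumes "\<tau> \<in> (\<Pi>\<^sub>E a\<in>obj C. arr D (omap F a) (omap G a))"
    and "\<And>a b f. \<lbrakk>a \<in> obj C; b \<in> obj C; f \<in> arr C a b\<rbrakk>
      \<Longrightarrow> cmp D (omap F a) (omap F b) (omap G b) (\<tau> b) (amap F a b f)
        = cmp D (omap F a) (omap G a) (omap G b) (amap G a b f) (\<tau> a)"
  shows "\<tau> \<in> nat_trans C D F G"
  using assms by (simp add: nat_trans_def)

lemma nat_trans_extensional:
  "\<tau> \<in> nat_trans C D F G \<Longrightarrow> \<tau> \<in> (\<Pi>\<^sub>E a\<in>obj C. arr D (omap F a) (omap G a))"
  by (simp add: nat_trans_def)

lemma nat_trans_component:
  "\<lbrakk>\<tau> \<in> nat_trans C D F G; a \<in> obj C\<rbrakk> \<Longrightarrow> \<tau> a \<in> arr D (omap F a) (omap G a)"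
  by (auto simp: nat_trans_def)

lemma nat_trans_natural:
  "\<lbrakk>\<tau> \<in> nat_trans C D F G; a \<in> obj C; b \<in> obj C; f \<in> arr C a b\<rbrakk>
    \<Longrightarrow> cmp D (omap F a) (omap F b) (omap G b) (\<tau> b) (amap F a b f)
      = cmp D (omap F a) (omap G a) (omap G b) (amap G a b f) (\<tau> a)"
  by (simp add: nat_trans_def)

lemma functor_cat_simps:
  "obj (functor_cat C D) = {F. cat_functor C D F}"
  "arr (functor_cat C D) = nat_trans C D"
  "ide (functor_cat C D) F = (\<lambda>a\<in>obj C. ide D (omap F a))"
  "cmp (functor_cat C D) F G H \<tau> \<sigma>
    = (\<lambda>a\<in>obj C. cmp D (omap F a) (omap G a) (omap H a) (\<tau> a) (\<sigma> a))"
  by (simp_all add: functor_cat_def)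

lemma nat_trans_compose:
  assumes F: "cat_functor C D F" and G: "cat_functor C D G" and H: "cat_functor C D H"
    and \<sigma>: "\<sigma> \<in> nat_trans C D F G" and \<tau>: "\<tau> \<in> nat_trans C D G H"
  shows "(\<lambda>a\<in>obj C. cmp D (omap F a) (omap G a) (omap H a) (\<tau> a) (\<sigma> a)) \<in> nat_trans C D F H"
proof -
  interpret F: cat_functor C D F by (fact F)
  interpret G: cat_functor C D G by (fact G)
  interpret H: cat_functor C D H by (fact H)
  note c = nat_trans_component[OF \<sigma>] nat_trans_component[OF \<tau>]
    F.omap_closed G.omap_closed H.omap_closed F.amap_closed G.amap_closed H.amap_closed
  show ?thesis
  proof (rule nat_transI)
    fix a b f assume f: "a \<in> obj C" "b \<in> obj C" "f \<in> arr C a b"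
    have "cmp D (omap F a) (omap F b) (omap H b)
        (cmp D (omap F b) (omap G b) (omap H b) (\<tau> b) (\<sigma> b)) (amap F a b f)
      = cmp D (omap F a) (omap G b) (omap H b) (\<tau> b)
        (cmp D (omap F a) (omap F b) (omap G b) (\<sigma> b) (amap F a b f))"
      using f c by (simp add: F.D.cmp_assoc)
    also have "\<dots> = cmp D (omap F a) (omap G a) (omap H b)
        (cmp D (omap G a) (omap G b) (omap H b) (\<tau> b) (amap G a b f)) (\<sigma> a)"
      using f c by (simp add: nat_trans_natural[OF \<sigma>] F.D.cmp_assoc)
    also have "\<dots> = cmp D (omap F a) (omap H a) (omap H b) (amap H a b f)
        (cmp D (omap F a) (omap G a) (omap H a) (\<tau> a) (\<sigma> a))"
      using f c by (simp add: nat_trans_natural[OF \<tau>] F.D.cmp_assoc)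
    finally show "cmp D (omap F a) (omap F b) (omap H b)
        ((\<lambda>a\<in>obj C. cmp D (omap F a) (omap G a) (omap H a) (\<tau> a) (\<sigma> a)) b) (amap F a b f)
      = cmp D (omap F a) (omap H a) (omap H b) (amap H a b f)
        ((\<lambda>a\<in>obj C. cmp D (omap F a) (omap G a) (omap H a) (\<tau> a) (\<sigma> a)) a)"
      using f by simp
  qed (use c F.D.cmp_closed in auto)
qed

lemma identities_natural:
  assumes F: "cat_functor C D F" and G: "cat_functor C D G"
    and omap_eq: "\<And>a. a \<in> obj C \<Longrightarrow> omap F a = omap G a"
    and amap_eq: "\<And>a b f. \<lbrakk>a \<in> obj C; b \<in> obj C; f \<in> arr C a b\<rbrakk> \<Longrightarrow> amap F a b f = amap G a b f"
  shows "(\<lambda>a\<in>obj C. ide D (omap F a)) \<in> nat_trans C D F G"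
proof -
  interpret F: cat_functor C D F by (fact F)
  interpret G: cat_functor C D G by (fact G)
  show ?thesis
  proof (rule nat_transI)
    show "(\<lambda>a\<in>obj C. ide D (omap F a)) \<in> (\<Pi>\<^sub>E a\<in>obj C. arr D (omap F a) (omap G a))"
      using F.D.ide_closed G.omap_closed by (auto simp: omap_eq)
  next
    fix a b f assume f: "a \<in> obj C" "b \<in> obj C" "f \<in> arr C a b"
    then show "cmp D (omap F a) (omap F b) (omap G b)
        ((\<lambda>a\<in>obj C. ide D (omap F a)) b) (amap F a b f)
      = cmp D (omap F a) (omap G a) (omap G b) (amap G a b f)
        ((\<lambda>a\<in>obj C. ide D (omap F a)) a)"
      using G.omap_closed G.amap_closed
      by (simp add: omap_eq amap_eq F.D.cmp_ide_left F.D.cmp_ide_right)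
  qed
qed

lemma category_functor_cat:
  assumes C: "category C" and D: "category D"
  shows "category (functor_cat C D)"
proof -
  interpret D: category D by (fact D)
  note o = cat_functor.omap_closed and c = nat_trans_component
  show ?thesis
  proof (unfold_locales, goal_cases)
    case (1 F)
    then show ?case by (simp add: functor_cat_simps identities_natural)
  next
    case (2 F G H \<sigma> \<tau>)
    then show ?case by (simp add: functor_cat_simps nat_trans_compose)
  next
    case (3 F G \<tau>)
    then show ?case
      by (auto simp: functor_cat_simps D.cmp_ide_left o[of C D] c[of \<tau> C D]
          PiE_iff intro!: extensionalityI[of _ "obj C"] dest: nat_trans_extensional)
  next
    case (4 F G \<tau>)
    then show ?case
      by (auto simp: functor_cat_simps D.cmp_ide_right o[of C D] c[of \<tau> C D]
          PiE_iff intro!: extensionalityI[of _ "obj C"] dest: nat_trans_extensional)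
  next
    case (5 F G H I \<rho> \<sigma> \<tau>)
    then show ?case
      by (auto simp: functor_cat_simps D.cmp_assoc o[of C D] c[of _ C D]
          intro!: restrict_ext D.cmp_assoc)
  qed
qed

text \<open>
  Functors are records with arbitrary values away from the objects and hom-sets of their domain.
  Two that agree where it matters may therefore differ, but the identities of the common values form
  an isomorphism between them.
\<close>

lemma isomorphic_in_functor_cat:
  assumes F: "cat_functor C D F" and G: "cat_functor C D G"
    and omap_eq: "\<And>a. a \<in> obj C \<Longrightarrow> omap F a = omap G a"
    and amap_eq: "\<And>a b f. \<lbrakk>a \<in> obj C; b \<in> obj C; f \<in> arr C a b\<rbrakk> \<Longrightarrow> amap F a b f = amap G a b f"
  shows "isomorphic_in (functor_cat C D) F G"
proof -
  interpret G: cat_functor C D G by (fact G)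
  let ?\<iota> = "\<lambda>a\<in>obj C. ide D (omap F a)"
  have \<iota>: "?\<iota> = (\<lambda>a\<in>obj C. ide D (omap G a))"
    by (auto simp: omap_eq)
  have "?\<iota> \<in> nat_trans C D F G"
    by (rule identities_natural[OF assms])
  moreover have "?\<iota> \<in> nat_trans C D G F"
    unfolding \<iota> by (rule identities_natural[OF G F]) (simp_all add: omap_eq amap_eq)
  moreover have "cmp (functor_cat C D) F G F ?\<iota> ?\<iota> = ?\<iota>" "cmp (functor_cat C D) G F G ?\<iota> ?\<iota> = ?\<iota>"
    using G.omap_closed
    by (auto simp: functor_cat_simps omap_eq G.D.cmp_ide_left G.D.ide_closed)
  moreover have "ide (functor_cat C D) F = ?\<iota>" "ide (functor_cat C D) G = ?\<iota>"
    by (simp_all only: functor_cat_simps \<iota>)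
  ultimately show ?thesis
    using F G unfolding isomorphic_in_def by (auto simp only: functor_cat_simps(1,2))
qed

text \<open>
  The category axioms for \<open>C\<close> only speak of hom-sets, identities and composites, so they are
  inherited from \<open>D\<close>. This spares separate verifications for categories of graded modules.
\<close>

lemma category_pullback:
  assumes D: "category D"
    and obj: "\<And>a. a \<in> obj C \<Longrightarrow> \<phi> a \<in> obj D"
    and arr: "\<And>a b. \<lbrakk>a \<in> obj C; b \<in> obj C\<rbrakk> \<Longrightarrow> arr C a b = arr D (\<phi> a) (\<phi> b)"
    and ide: "\<And>a. a \<in> obj C \<Longrightarrow> ide C a = ide D (\<phi> a)"
    and cmp: "\<And>a b c f g. \<lbrakk>a \<in> obj C; b \<in> obj C; c \<in> obj C; f \<in> arr C a b; g \<in> arr C b c\<rbrakk>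
      \<Longrightarrow> cmp C a b c g f = cmp D (\<phi> a) (\<phi> b) (\<phi> c) g f"
  shows "category C"
proof -
  interpret D: category D by (fact D)
  show ?thesis
    by unfold_locales
      (simp_all add: obj arr ide cmp D.ide_closed D.cmp_closed D.cmp_ide_left D.cmp_ide_right
        D.cmp_assoc)
qed

text \<open>
  The usual argument that a fully faithful and essentially surjective functor is an equivalence, in
  the case where the functor does not change arrows. A choice of a preimage \<open>\<gamma> d\<close> and of an isomorphism
  \<open>e d\<close> onto \<open>d\<close> for each object \<open>d\<close> gives the quasi-inverse; the \<open>e d\<close> themselves are the components of
  both natural isomorphisms.
\<close>

lemma equivalence_by_hom_identification:
  assumes D: "category D"
    and obj: "\<And>a. a \<in> obj C \<Longrightarrow> \<phi> a \<in> obj D"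
    and arr: "\<And>a b. \<lbrakk>a \<in> obj C; b \<in> obj C\<rbrakk> \<Longrightarrow> arr C a b = arr D (\<phi> a) (\<phi> b)"
    and ide: "\<And>a. a \<in> obj C \<Longrightarrow> ide C a = ide D (\<phi> a)"
    and cmp: "\<And>a b c f g. \<lbrakk>a \<in> obj C; b \<in> obj C; c \<in> obj C; f \<in> arr C a b; g \<in> arr C b c\<rbrakk>
      \<Longrightarrow> cmp C a b c g f = cmp D (\<phi> a) (\<phi> b) (\<phi> c) g f"
    and dense: "\<And>d. d \<in> obj D \<Longrightarrow> \<exists>a\<in>obj C. isomorphic_in D (\<phi> a) d"
  shows "equivalence_of_categories C D \<lparr>omap = \<phi>, amap = (\<lambda>a b f. f)\<rparr>"
proof -
  interpret D: category D by (fact D)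
  interpret C: category C by (rule category_pullback[OF assms(1-5)])
  let ?F = "\<lparr>omap = \<phi>, amap = (\<lambda>a b f. f)\<rparr>"
  have F: "cat_functor C D ?F"
    by unfold_locales (simp_all add: obj arr ide cmp)
  have "\<forall>d\<in>obj D. \<exists>a e e'. a \<in> obj C \<and> e \<in> arr D (\<phi> a) d \<and> e' \<in> arr D d (\<phi> a) \<and>
      cmp D (\<phi> a) d (\<phi> a) e' e = ide D (\<phi> a) \<and> cmp D d (\<phi> a) d e e' = ide D d"
    using dense unfolding isomorphic_in_def by blast
  then obtain \<gamma> e e' where
    \<gamma>: "\<And>d. d \<in> obj D \<Longrightarrow> \<gamma> d \<in> obj C" and
    e: "\<And>d. d \<in> obj D \<Longrightarrow> e d \<in> arr D (\<phi> (\<gamma> d)) d" and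
    e': "\<And>d. d \<in> obj D \<Longrightarrow> e' d \<in> arr D d (\<phi> (\<gamma> d))" and
    e'e: "\<And>d. d \<in> obj D \<Longrightarrow> cmp D (\<phi> (\<gamma> d)) d (\<phi> (\<gamma> d)) (e' d) (e d) = ide D (\<phi> (\<gamma> d))" and
    ee': "\<And>d. d \<in> obj D \<Longrightarrow> cmp D d (\<phi> (\<gamma> d)) d (e d) (e' d) = ide D d"
    by metis
  \<comment> \<open>Conjugation by the chosen isomorphisms makes the choice of preimages functorial.\<close>
  define c where "c a b f = cmp D (\<phi> (\<gamma> a)) b (\<phi> (\<gamma> b)) (e' b) (cmp D (\<phi> (\<gamma> a)) a b f (e a))"
    for a b f
  let ?G = "\<lparr>omap = \<gamma>, amap = c\<rparr>"
  note [simp] = obj \<gamma> e e'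
  have c_closed: "c a b f \<in> arr D (\<phi> (\<gamma> a)) (\<phi> (\<gamma> b))"
    if "a \<in> obj D" "b \<in> obj D" "f \<in> arr D a b" for a b f
    unfolding c_def using that by (meson D.cmp_closed obj \<gamma> e e')
  have ec: "cmp D (\<phi> (\<gamma> a)) (\<phi> (\<gamma> b)) b (e b) (c a b f) = cmp D (\<phi> (\<gamma> a)) a b f (e a)"
    if "a \<in> obj D" "b \<in> obj D" "f \<in> arr D a b" for a b f
  proof -
    have "cmp D (\<phi> (\<gamma> a)) a b f (e a) \<in> arr D (\<phi> (\<gamma> a)) b"
      using that by (meson D.cmp_closed obj \<gamma> e)
    then show ?thesis
      unfolding c_def
      using that D.cmp_assoc[of _ b "\<phi> (\<gamma> b)" b "cmp D (\<phi> (\<gamma> a)) a b f (e a)" "e' b" "e b"]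
      by (simp add: ee' D.cmp_ide_left)
  qed
  have ce': "cmp D a (\<phi> (\<gamma> a)) (\<phi> (\<gamma> b)) (c a b f) (e' a) = cmp D a b (\<phi> (\<gamma> b)) (e' b) f"
    if "a \<in> obj D" "b \<in> obj D" "f \<in> arr D a b" for a b f
  proof -
    have fe: "cmp D (\<phi> (\<gamma> a)) a b f (e a) \<in> arr D (\<phi> (\<gamma> a)) b"
      using that by (meson D.cmp_closed obj \<gamma> e)
    have "cmp D a (\<phi> (\<gamma> a)) (\<phi> (\<gamma> b)) (c a b f) (e' a)
        = cmp D a b (\<phi> (\<gamma> b)) (e' b) (cmp D a (\<phi> (\<gamma> a)) b (cmp D (\<phi> (\<gamma> a)) a b f (e a)) (e' a))"
      unfolding c_def using that fe by (simp add: D.cmp_assoc)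
    also have "cmp D a (\<phi> (\<gamma> a)) b (cmp D (\<phi> (\<gamma> a)) a b f (e a)) (e' a) = f"
      using that D.cmp_assoc[of a "\<phi> (\<gamma> a)" a b "e' a" "e a" f]
      by (simp add: ee' D.cmp_ide_right)
    finally show ?thesis .
  qed
  have c_ide: "c a a (ide D a) = ide D (\<phi> (\<gamma> a))" if "a \<in> obj D" for a
    unfolding c_def using that by (simp add: D.cmp_ide_left e'e)
  have c_cmp: "c a b' (cmp D a b b' g f)
      = cmp D (\<phi> (\<gamma> a)) (\<phi> (\<gamma> b)) (\<phi> (\<gamma> b')) (c b b' g) (c a b f)"
    if "a \<in> obj D" "b \<in> obj D" "b' \<in> obj D" "f \<in> arr D a b" "g \<in> arr D b b'" for a b b' f g
  proof -
    have fe: "cmp D (\<phi> (\<gamma> a)) a b f (e a) \<in> arr D (\<phi> (\<gamma> a)) b"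
      and ge: "cmp D (\<phi> (\<gamma> b)) b b' g (e b) \<in> arr D (\<phi> (\<gamma> b)) b'"
      using that by (meson D.cmp_closed obj \<gamma> e)+
    have "cmp D (\<phi> (\<gamma> a)) (\<phi> (\<gamma> b)) (\<phi> (\<gamma> b')) (c b b' g) (c a b f)
      = cmp D (\<phi> (\<gamma> a)) b' (\<phi> (\<gamma> b')) (e' b') (cmp D (\<phi> (\<gamma> a)) (\<phi> (\<gamma> b)) b'
          (cmp D (\<phi> (\<gamma> b)) b b' g (e b)) (c a b f))"
      using that ge c_closed by (simp add: c_def[of b b' g] D.cmp_assoc)
    also have "cmp D (\<phi> (\<gamma> a)) (\<phi> (\<gamma> b)) b' (cmp D (\<phi> (\<gamma> b)) b b' g (e b)) (c a b f)
      = cmp D (\<phi> (\<gamma> a)) b b' g (cmp D (\<phi> (\<gamma> a)) (\<phi> (\<gamma> b)) b (e b) (c a b f))"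
      using that c_closed by (simp add: D.cmp_assoc)
    also have "\<dots> = cmp D (\<phi> (\<gamma> a)) a b' (cmp D a b b' g f) (e a)"
      using that by (simp add: ec D.cmp_assoc)
    finally show ?thesis by (simp add: c_def)
  qed
  have G: "cat_functor D C ?G"
    by unfold_locales (simp_all add: arr c_closed c_ide ide c_cmp cmp)
  have idC: "cat_functor C C id_functor" and idD: "cat_functor D D id_functor"
    by (unfold_locales; simp add: id_functor_def)+
  have GF: "cat_functor C C (comp_functor ?G ?F)" and FG: "cat_functor D D (comp_functor ?F ?G)"
    by (unfold_locales; simp add: comp_functor_def arr c_closed c_ide ide c_cmp cmp)+
  have "isomorphic_in (functor_cat C C) id_functor (comp_functor ?G ?F)"
    unfolding isomorphic_in_def
  proof (intro conjI bexI)
    show "(\<lambda>a\<in>obj C. e' (\<phi> a)) \<in> arr (functor_cat C C) id_functor (comp_functor ?G ?F)"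
      by (auto simp: functor_cat_simps nat_trans_def id_functor_def comp_functor_def
          arr cmp c_closed ce')
    show "(\<lambda>a\<in>obj C. e (\<phi> a)) \<in> arr (functor_cat C C) (comp_functor ?G ?F) id_functor"
      by (auto simp: functor_cat_simps nat_trans_def id_functor_def comp_functor_def
          arr cmp c_closed ec)
    show "cmp (functor_cat C C) id_functor (comp_functor ?G ?F) id_functor
        (\<lambda>a\<in>obj C. e (\<phi> a)) (\<lambda>a\<in>obj C. e' (\<phi> a)) = ide (functor_cat C C) id_functor"
      "cmp (functor_cat C C) (comp_functor ?G ?F) id_functor (comp_functor ?G ?F)
        (\<lambda>a\<in>obj C. e' (\<phi> a)) (\<lambda>a\<in>obj C. e (\<phi> a)) = ide (functor_cat C C) (comp_functor ?G ?F)"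
      by (auto simp: functor_cat_simps id_functor_def comp_functor_def arr cmp ide ee' e'e)
  qed (use idC GF in \<open>simp_all add: functor_cat_simps\<close>)
  moreover have "isomorphic_in (functor_cat D D) (comp_functor ?F ?G) id_functor"
    unfolding isomorphic_in_def
  proof (intro conjI bexI)
    show "(\<lambda>d\<in>obj D. e' d) \<in> arr (functor_cat D D) id_functor (comp_functor ?F ?G)"
      by (auto simp: functor_cat_simps nat_trans_def id_functor_def comp_functor_def ce')
    show "(\<lambda>d\<in>obj D. e d) \<in> arr (functor_cat D D) (comp_functor ?F ?G) id_functor"
      by (auto simp: functor_cat_simps nat_trans_def id_functor_def comp_functor_def ec)
    show "cmp (functor_cat D D) id_functor (comp_functor ?F ?G) id_functor
        (\<lambda>d\<in>obj D. e d) (\<lambda>d\<in>obj D. e' d) = ide (functor_cat D D) id_functor"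
      "cmp (functor_cat D D) (comp_functor ?F ?G) id_functor (comp_functor ?F ?G)
        (\<lambda>d\<in>obj D. e' d) (\<lambda>d\<in>obj D. e d) = ide (functor_cat D D) (comp_functor ?F ?G)"
      by (auto simp: functor_cat_simps id_functor_def comp_functor_def ee' e'e)
  qed (use idD FG in \<open>simp_all add: functor_cat_simps\<close>)
  ultimately show ?thesis
    unfolding equivalence_of_categories_def using F G by blast
qed


section \<open>Linear maps, quotients and free modules\<close>

lemma lin_mapsI:
  assumes "f \<in> carrier M \<rightarrow>\<^sub>E carrier N"
    and "\<And>u v. \<lbrakk>u \<in> carrier M; v \<in> carrier M\<rbrakk> \<Longrightarrow> f (u \<oplus>\<^bsub>M\<^esub> v) = f u \<oplus>\<^bsub>N\<^esub> f v"
    and "\<And>k v. \<lbrakk>k \<in> carrier K; v \<in> carrier M\<rbrakk> \<Longrightarrow> f (k \<odot>\<^bsub>M\<^esub> v) = k \<odot>\<^bsub>N\<^esub> f v"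
  shows "f \<in> lin_maps K M N"
  using assms by (simp add: lin_maps_def)

lemma lin_mapsD:
  assumes "f \<in> lin_maps K M N"
  shows "f \<in> carrier M \<rightarrow>\<^sub>E carrier N"
    and "u \<in> carrier M \<Longrightarrow> f u \<in> carrier N"
    and "\<lbrakk>u \<in> carrier M; v \<in> carrier M\<rbrakk> \<Longrightarrow> f (u \<oplus>\<^bsub>M\<^esub> v) = f u \<oplus>\<^bsub>N\<^esub> f v"
    and "\<lbrakk>k \<in> carrier K; u \<in> carrier M\<rbrakk> \<Longrightarrow> f (k \<odot>\<^bsub>M\<^esub> u) = k \<odot>\<^bsub>N\<^esub> f u"
  using assms by (auto simp: lin_maps_def)

lemma lin_maps_ext:
  assumes "f \<in> lin_maps K M N" "g \<in> lin_maps K M P"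
    and "\<And>u. u \<in> carrier M \<Longrightarrow> f u = g u"
  shows "f = g"
  using assms by (auto simp: lin_maps_def PiE_iff intro: extensionalityI)

lemma lin_maps_identity: "module K M \<Longrightarrow> (\<lambda>v\<in>carrier M. v) \<in> lin_maps K M M"
  by (intro lin_mapsI)
    (auto simp: module.smult_closed abelian_groupE(1)[OF module.axioms(2)])

lemma lin_maps_compose:
  assumes M: "module K M" and f: "f \<in> lin_maps K M N" and g: "g \<in> lin_maps K N P"
  shows "compose (carrier M) g f \<in> lin_maps K M P"
proof -
  interpret M: module K M by (fact M)
  show ?thesis
    using lin_mapsD[OF f] lin_mapsD[OF g] by (intro lin_mapsI) (auto simp: compose_def)
qed

lemma lin_maps_zero:
  assumes "module K M" "module K N" "f \<in> lin_maps K M N"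
  shows "f \<zero>\<^bsub>M\<^esub> = \<zero>\<^bsub>N\<^esub>"
proof -
  interpret M: module K M by fact
  interpret N: module K N by fact
  have "f (\<zero>\<^bsub>K\<^esub> \<odot>\<^bsub>M\<^esub> \<zero>\<^bsub>M\<^esub>) = \<zero>\<^bsub>K\<^esub> \<odot>\<^bsub>N\<^esub> f \<zero>\<^bsub>M\<^esub>"
    by (rule lin_mapsD[OF assms(3)]) auto
  then show ?thesis
    using lin_mapsD(2)[OF assms(3)] by simp
qed

lemma mod_cat_simps:
  "obj (mod_cat K) = {M. module K M}"
  "arr (mod_cat K) = lin_maps K"
  "ide (mod_cat K) M = (\<lambda>v\<in>carrier M. v)"
  "cmp (mod_cat K) M N P g f = compose (carrier M) g f"
  by (simp_all add: mod_cat_def)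

lemma category_mod_cat: "category (mod_cat K)"
proof (unfold_locales, goal_cases)
  case 1
  then show ?case by (simp add: mod_cat_simps lin_maps_identity)
next
  case 2
  then show ?case by (simp add: mod_cat_simps lin_maps_compose)
next
  case (3 M N f)
  then have "f \<in> carrier M \<rightarrow>\<^sub>E carrier N"
    by (simp add: mod_cat_simps lin_mapsD(1))
  then show ?case
    by (auto simp: mod_cat_simps compose_def PiE_iff intro!: extensionalityI[of _ "carrier M"])
next
  case (4 M N f)
  then have "f \<in> carrier M \<rightarrow>\<^sub>E carrier N"
    by (simp add: mod_cat_simps lin_mapsD(1))
  then show ?case
    by (auto simp: mod_cat_simps compose_def PiE_iff intro!: extensionalityI[of _ "carrier M"])
next
  case (5 M N P Q f g h)
  then have "f \<in> carrier M \<rightarrow>\<^sub>E carrier N"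
    by (simp add: mod_cat_simps lin_mapsD(1))
  then show ?case
    by (auto simp: mod_cat_simps compose_def PiE_iff intro!: extensionalityI[of _ "carrier M"])
qed

lemma submodule_abelian_subgroup:
  assumes "module K M" "submodule H K M"
  shows "abelian_subgroup H M"
  by (intro abelian_subgroupI3 additive_subgroupI submodule.axioms(1)[OF assms(2)]
      module.axioms(2)[OF assms(1)])

text \<open>
  The scalar multiple of a coset is defined as a union over all its representatives. Since \<open>H\<close> is
  stable under scalars, all members of that union are the same coset.
\<close>

lemma lin_maps_coset:
  assumes M: "module K M" and H: "submodule H K M"
  shows "(\<lambda>u\<in>carrier M. H +>\<^bsub>M\<^esub> u) \<in> lin_maps K M (quotient_module M H)"
proof -
  interpret M: module K M by (fact M)
  interpret H: abelian_subgroup H M by (rule submodule_abelian_subgroup[OF M H])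
  show ?thesis
  proof (rule lin_mapsI)
    show "(\<lambda>u\<in>carrier M. H +>\<^bsub>M\<^esub> u) \<in> carrier M \<rightarrow>\<^sub>E carrier (quotient_module M H)"
      using M.a_rcosetsI[OF H.a_subset] by (auto simp: quotient_module_def)
  next
    fix u v assume "u \<in> carrier M" "v \<in> carrier M"
    then show "(\<lambda>u\<in>carrier M. H +>\<^bsub>M\<^esub> u) (u \<oplus>\<^bsub>M\<^esub> v)
        = (\<lambda>u\<in>carrier M. H +>\<^bsub>M\<^esub> u) u \<oplus>\<^bsub>quotient_module M H\<^esub> (\<lambda>u\<in>carrier M. H +>\<^bsub>M\<^esub> u) v"
      by (simp add: quotient_module_def H.a_rcos_sum)
  next
    fix k v assume k: "k \<in> carrier K" and v: "v \<in> carrier M"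
    have "H +>\<^bsub>M\<^esub> (k \<odot>\<^bsub>M\<^esub> w) = H +>\<^bsub>M\<^esub> (k \<odot>\<^bsub>M\<^esub> v)" if "w \<in> H +>\<^bsub>M\<^esub> v" for w
    proof -
      from that obtain h where h: "h \<in> H" "w = h \<oplus>\<^bsub>M\<^esub> v"
        by (auto simp: a_r_coset_def r_coset_def)
      then have "k \<odot>\<^bsub>M\<^esub> h \<in> H" and "k \<odot>\<^bsub>M\<^esub> w = k \<odot>\<^bsub>M\<^esub> h \<oplus>\<^bsub>M\<^esub> k \<odot>\<^bsub>M\<^esub> v"
        using k v H.a_subset by (auto simp: submodule.smult_closed[OF H] M.smult_r_distr)
      then have "k \<odot>\<^bsub>M\<^esub> w \<in> H +>\<^bsub>M\<^esub> (k \<odot>\<^bsub>M\<^esub> v)"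
        by (auto simp: a_r_coset_def r_coset_def)
      then show ?thesis
        using H.a_repr_independence' k v by auto
    qed
    moreover have "v \<in> H +>\<^bsub>M\<^esub> v"
      using v by (rule H.a_rcos_self)
    ultimately have "(\<Union>w\<in>H +>\<^bsub>M\<^esub> v. H +>\<^bsub>M\<^esub> (k \<odot>\<^bsub>M\<^esub> w)) = H +>\<^bsub>M\<^esub> (k \<odot>\<^bsub>M\<^esub> v)"
      by blast
    then show "(\<lambda>u\<in>carrier M. H +>\<^bsub>M\<^esub> u) (k \<odot>\<^bsub>M\<^esub> v)
        = k \<odot>\<^bsub>quotient_module M H\<^esub> (\<lambda>u\<in>carrier M. H +>\<^bsub>M\<^esub> u) v"
      using k v by (simp add: quotient_module_def)
  qed
qed

lemma coset_eqI:
  assumes M: "module K M" and H: "submodule H K M"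
    and "u \<in> carrier M" "v \<in> carrier M" "u \<ominus>\<^bsub>M\<^esub> v \<in> H"
  shows "H +>\<^bsub>M\<^esub> u = H +>\<^bsub>M\<^esub> v"
proof -
  interpret M: module K M by (fact M)
  interpret H: abelian_subgroup H M by (rule submodule_abelian_subgroup[OF M H])
  have "u \<in> H +>\<^bsub>M\<^esub> v"
    using assms H.a_rcos_module[of v u] by (simp add: a_minus_def)
  then show ?thesis
    using H.a_repr_independence' assms by auto
qed

lemma quotient_module_lift:
  assumes M: "module K M" and P: "module K P" and H: "submodule H K M"
    and f: "f \<in> lin_maps K M P" and vanish: "\<And>u. u \<in> H \<Longrightarrow> f u = \<zero>\<^bsub>P\<^esub>"
  obtains h where "h \<in> lin_maps K (quotient_module M H) P"
    and "\<And>u. u \<in> carrier M \<Longrightarrow> h (H +>\<^bsub>M\<^esub> u) = f u"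
proof -
  interpret M: module K M by (fact M)
  interpret P: module K P by (fact P)
  interpret H: abelian_subgroup H M by (rule submodule_abelian_subgroup[OF M H])
  let ?Q = "quotient_module M H"
  note f_lin = lin_mapsD[OF f]
  define h where "h = (\<lambda>U\<in>carrier ?Q. f (SOME u. u \<in> U))"
  have coset: "\<exists>u\<in>carrier M. U = H +>\<^bsub>M\<^esub> u" if "U \<in> carrier ?Q" for U
    using that by (auto simp: quotient_module_def A_RCOSETS_def RCOSETS_def a_r_coset_def)
  note pr = lin_mapsD[OF lin_maps_coset[OF M H]]
  have h: "h (H +>\<^bsub>M\<^esub> u) = f u" if u: "u \<in> carrier M" for u
  proof -
    have "(SOME w. w \<in> H +>\<^bsub>M\<^esub> u) \<in> H +>\<^bsub>M\<^esub> u"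
      using H.a_rcos_self[OF u] by (rule someI)
    then obtain w where "w \<in> H" "(SOME w. w \<in> H +>\<^bsub>M\<^esub> u) = w \<oplus>\<^bsub>M\<^esub> u"
      by (auto simp: a_r_coset_def r_coset_def)
    then have "f (SOME w. w \<in> H +>\<^bsub>M\<^esub> u) = f u"
      using u H.a_subset f_lin by (auto simp: vanish)
    then show ?thesis
      using pr(2)[OF u] u by (simp add: h_def)
  qed
  have "h \<in> lin_maps K ?Q P"
  proof (rule lin_mapsI)
    show "h \<in> carrier ?Q \<rightarrow>\<^sub>E carrier P"
    proof (rule PiE_I)
      fix U assume "U \<in> carrier ?Q"
      then show "h U \<in> carrier P" using coset h f_lin(2) by metis
    qed (simp add: h_def)
  next
    fix U V assume "U \<in> carrier ?Q" "V \<in> carrier ?Q"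
    then obtain u v where "u \<in> carrier M" "v \<in> carrier M" "U = H +>\<^bsub>M\<^esub> u" "V = H +>\<^bsub>M\<^esub> v"
      using coset by blast
    then show "h (U \<oplus>\<^bsub>?Q\<^esub> V) = h U \<oplus>\<^bsub>P\<^esub> h V"
      using pr(3)[of u v, symmetric] by (simp add: h f_lin)
  next
    fix k U assume k: "k \<in> carrier K" and "U \<in> carrier ?Q"
    then obtain u where "u \<in> carrier M" "U = H +>\<^bsub>M\<^esub> u"
      using coset by blast
    then show "h (k \<odot>\<^bsub>?Q\<^esub> U) = k \<odot>\<^bsub>P\<^esub> h U"
      using k pr(4)[of k u, symmetric] by (simp add: h f_lin)
  qed
  with h show thesis by (rule that[rotated])
qed

lemma submodule_span:
  assumes M: "module K M" and S: "S \<subseteq> carrier M"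
  shows "submodule (submodule_span K M S) K M" and "S \<subseteq> submodule_span K M S"
    and "\<lbrakk>submodule H K M; S \<subseteq> H\<rbrakk> \<Longrightarrow> submodule_span K M S \<subseteq> H"
proof -
  interpret M: module K M by (fact M)
  show "submodule (submodule_span K M S) K M"
  proof (rule M.submoduleI)
    show "submodule_span K M S \<subseteq> carrier M"
      using M.carrier_is_submodule S by (auto simp: submodule_span_def)
    have "\<zero>\<^bsub>M\<^esub> \<in> H" if "submodule H K M" for H
      using subgroup.one_closed[OF submodule.axioms(1)[OF that]] by simp
    then show "\<zero>\<^bsub>M\<^esub> \<in> submodule_span K M S"
      by (simp add: submodule_span_def)
  next
    fix u assume "u \<in> submodule_span K M S"
    then show "\<ominus>\<^bsub>M\<^esub> u \<in> submodule_span K M S"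
      by (simp add: submodule_span_def M.submoduleE(3))
  next
    fix u v assume "u \<in> submodule_span K M S" "v \<in> submodule_span K M S"
    then show "u \<oplus>\<^bsub>M\<^esub> v \<in> submodule_span K M S"
      by (simp add: submodule_span_def M.submoduleE(5))
  next
    fix k u assume "k \<in> carrier K" "u \<in> submodule_span K M S"
    then show "k \<odot>\<^bsub>M\<^esub> u \<in> submodule_span K M S"
      by (simp add: submodule_span_def M.submoduleE(4))
  qed
qed (auto simp: submodule_span_def)

lemma free_module_simps:
  "carrier (free_module K S)
    = {f. (\<forall>s. f s \<in> carrier K) \<and> (\<forall>s. s \<notin> S \<longrightarrow> f s = \<zero>\<^bsub>K\<^esub>) \<and> finite {s. f s \<noteq> \<zero>\<^bsub>K\<^esub>}}"
  "f \<oplus>\<^bsub>free_module K S\<^esub> g = (\<lambda>s. f s \<oplus>\<^bsub>K\<^esub> g s)"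
  "\<zero>\<^bsub>free_module K S\<^esub> = (\<lambda>s. \<zero>\<^bsub>K\<^esub>)"
  "k \<odot>\<^bsub>free_module K S\<^esub> f = (\<lambda>s. k \<otimes>\<^bsub>K\<^esub> f s)"
  by (simp_all add: free_module_def)

context cring
begin

lemma free_module_module: "module R (free_module R S)"
proof -
  let ?F = "free_module R S"
  have add: "(\<lambda>s. f s \<oplus> g s) \<in> carrier ?F" if "f \<in> carrier ?F" "g \<in> carrier ?F" for f g
  proof -
    have "{s. f s \<oplus> g s \<noteq> \<zero>} \<subseteq> {s. f s \<noteq> \<zero>} \<union> {s. g s \<noteq> \<zero>}" by auto
    then have "finite {s. f s \<oplus> g s \<noteq> \<zero>}"
      by (rule finite_subset) (use that in \<open>simp add: free_module_simps\<close>)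
    then show ?thesis
      using that by (simp add: free_module_simps)
  qed
  have smult: "(\<lambda>s. k \<otimes> f s) \<in> carrier ?F" if "k \<in> carrier R" "f \<in> carrier ?F" for k f
  proof -
    have "{s. k \<otimes> f s \<noteq> \<zero>} \<subseteq> {s. f s \<noteq> \<zero>}" using that by auto
    then have "finite {s. k \<otimes> f s \<noteq> \<zero>}"
      by (rule finite_subset) (use that in \<open>simp add: free_module_simps\<close>)
    then show ?thesis
      using that by (simp add: free_module_simps)
  qed
  show ?thesis
  proof (rule moduleI)
    show "abelian_group ?F"
    proof (rule abelian_groupI)
      fix f assume f: "f \<in> carrier ?F"
      then have "(\<lambda>s. (\<ominus> \<one>) \<otimes> f s) \<in> carrier ?F" by (intro smult) auto
      moreover have "(\<lambda>s. (\<ominus> \<one>) \<otimes> f s) \<oplus>\<^bsub>?F\<^esub> f = \<zero>\<^bsub>?F\<^esub>"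
        using f by (auto simp: free_module_simps l_minus l_neg)
      ultimately show "\<exists>g\<in>carrier ?F. g \<oplus>\<^bsub>?F\<^esub> f = \<zero>\<^bsub>?F\<^esub>" by blast
    next
      fix f g assume "f \<in> carrier ?F" "g \<in> carrier ?F"
      then show "f \<oplus>\<^bsub>?F\<^esub> g \<in> carrier ?F" by (simp add: add free_module_simps(2))
    next
      show "\<zero>\<^bsub>?F\<^esub> \<in> carrier ?F" by (simp add: free_module_simps)
    next
      fix f g h assume "f \<in> carrier ?F" "g \<in> carrier ?F" "h \<in> carrier ?F"
      then show "f \<oplus>\<^bsub>?F\<^esub> g \<oplus>\<^bsub>?F\<^esub> h = f \<oplus>\<^bsub>?F\<^esub> (g \<oplus>\<^bsub>?F\<^esub> h)"
        by (simp add: free_module_simps a_assoc)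
    next
      fix f g assume "f \<in> carrier ?F" "g \<in> carrier ?F"
      then show "f \<oplus>\<^bsub>?F\<^esub> g = g \<oplus>\<^bsub>?F\<^esub> f"
        by (intro ext) (simp add: free_module_simps a_comm)
    next
      fix f assume "f \<in> carrier ?F"
      then show "\<zero>\<^bsub>?F\<^esub> \<oplus>\<^bsub>?F\<^esub> f = f"
        by (simp add: free_module_simps)
    qed
  next
    fix k f assume "k \<in> carrier R" "f \<in> carrier ?F"
    then show "k \<odot>\<^bsub>?F\<^esub> f \<in> carrier ?F" by (simp add: smult free_module_simps(4))
  qed (simp_all add: free_module_simps l_distr r_distr m_assoc is_cring)
qed

lemma free_gen_closed: "s \<in> S \<Longrightarrow> free_gen R s \<in> carrier (free_module R S)"
proof -
  have "{t. free_gen R s t \<noteq> \<zero>} \<subseteq> {s}" by (auto simp: free_gen_def)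
  then have "finite {t. free_gen R s t \<noteq> \<zero>}"
    by (rule finite_subset) simp
  then show "s \<in> S \<Longrightarrow> free_gen R s \<in> carrier (free_module R S)"
    by (auto simp: free_module_simps free_gen_def)
qed

text \<open>
  Elements have finite support, so they are reached from zero by adding one multiple of a generator
  at a time.
\<close>

lemma free_module_induct [consumes 1, case_names zero add]:
  assumes f: "f \<in> carrier (free_module R S)"
    and zero: "Q (\<lambda>s. \<zero>)"
    and add: "\<And>k s g. \<lbrakk>k \<in> carrier R; s \<in> S; g \<in> carrier (free_module R S); Q g\<rbrakk>
      \<Longrightarrow> Q (k \<odot>\<^bsub>free_module R S\<^esub> free_gen R s \<oplus>\<^bsub>free_module R S\<^esub> g)"
  shows "Q f"
proof -
  have "finite {s. f s \<noteq> \<zero>}" using f by (simp add: free_module_simps)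
  then show ?thesis
    using f
  proof (induction "{s. f s \<noteq> \<zero>}" arbitrary: f rule: finite_induct)
    case empty
    then have "f = (\<lambda>s. \<zero>)" by auto
    then show ?case using zero by simp
  next
    case (insert s A)
    let ?g = "f(s := \<zero>)"
    have A: "A = {t. ?g t \<noteq> \<zero>}" using insert.hyps by auto
    have g: "?g \<in> carrier (free_module R S)"
      using insert.prems insert.hyps(1) A by (auto simp: free_module_simps)
    have "s \<in> S"
      using insert.hyps(4) insert.prems by (auto simp: free_module_simps)
    then have "Q (f s \<odot>\<^bsub>free_module R S\<^esub> free_gen R s \<oplus>\<^bsub>free_module R S\<^esub> ?g)"
      using insert.prems g insert.hyps(3)[OF A g] by (intro add) (auto simp: free_module_simps)
    moreover have "f s \<odot>\<^bsub>free_module R S\<^esub> free_gen R s \<oplus>\<^bsub>free_module R S\<^esub> ?g = f"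
      using insert.prems by (auto simp: free_module_simps free_gen_def)
    ultimately show ?case by simp
  qed
qed

lemma free_module_hom_eqI:
  assumes P: "module R P"
    and g: "g \<in> lin_maps R (free_module R S) P" and h: "h \<in> lin_maps R (free_module R S) P"
    and gens: "\<And>s. s \<in> S \<Longrightarrow> g (free_gen R s) = h (free_gen R s)"
  shows "g = h"
proof (rule lin_maps_ext[OF g h])
  interpret F: module R "free_module R S" by (rule free_module_module)
  fix f assume "f \<in> carrier (free_module R S)"
  then show "g f = h f"
  proof (induction rule: free_module_induct)
    case zero
    then show ?case
      using lin_maps_zero[OF free_module_module P g] lin_maps_zero[OF free_module_module P h]
      by (simp add: free_module_simps)
  next
    case (add k s f)
    then show ?case
      by (simp add: lin_mapsD[OF g] lin_mapsD[OF h] free_gen_closed gens)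
  qed
qed

text \<open>
  The extension of \<open>\<beta>\<close> sends \<open>f\<close> to \<open>\<Sum>\<^sub>s f(s) \<beta>(s)\<close>, summed over the support of \<open>f\<close>. The support
  changes with \<open>f\<close>; linearity is checked after enlarging the index sets to a common finite set, which
  adds only zero terms.
\<close>

lemma free_module_lift:
  assumes P: "module R P" and \<beta>: "\<beta> \<in> S \<rightarrow> carrier P"
  obtains h where "h \<in> lin_maps R (free_module R S) P"
    and "\<And>s. s \<in> S \<Longrightarrow> h (free_gen R s) = \<beta> s"
proof -
  interpret P: module R P by (fact P)
  let ?F = "free_module R S"
  interpret F: module R ?F by (rule free_module_module)
  define h where
    "h = (\<lambda>f\<in>carrier ?F. finsum P (\<lambda>s. f s \<odot>\<^bsub>P\<^esub> \<beta> s) {s. f s \<noteq> \<zero>})"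
  have summand: "(\<lambda>s. f s \<odot>\<^bsub>P\<^esub> \<beta> s) \<in> B \<rightarrow> carrier P"
    if "f \<in> carrier ?F" "B \<subseteq> S" for f B
    using that \<beta> by (auto simp: free_module_simps)
  have h: "h f = finsum P (\<lambda>s. f s \<odot>\<^bsub>P\<^esub> \<beta> s) B"
    if "f \<in> carrier ?F" "finite B" "B \<subseteq> S" "{s. f s \<noteq> \<zero>} \<subseteq> B" for f B
  proof -
    have "finsum P (\<lambda>s. f s \<odot>\<^bsub>P\<^esub> \<beta> s) {s. f s \<noteq> \<zero>} = finsum P (\<lambda>s. f s \<odot>\<^bsub>P\<^esub> \<beta> s) B"
      using that \<beta> summand[OF that(1,3)] by (intro P.add.finprod_mono_neutral_cong_left) (auto intro!: P.smult_l_null)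
    then show ?thesis using that(1) by (simp add: h_def)
  qed
  have supp: "finite {s. f s \<noteq> \<zero>}" "{s. f s \<noteq> \<zero>} \<subseteq> S" if "f \<in> carrier ?F" for f
    using that by (auto simp: free_module_simps)
  have "h \<in> lin_maps R ?F P"
  proof (rule lin_mapsI)
    show "h \<in> carrier ?F \<rightarrow>\<^sub>E carrier P"
      using summand[OF _ supp(2)] by (auto simp: h_def)
  next
    fix f g assume f: "f \<in> carrier ?F" and g: "g \<in> carrier ?F"
    let ?B = "{s. f s \<noteq> \<zero>} \<union> {s. g s \<noteq> \<zero>}"
    have B: "finite ?B" "?B \<subseteq> S"
      using supp f g by auto
    have fg: "f \<oplus>\<^bsub>?F\<^esub> g \<in> carrier ?F"
      using f g by simp
    have "h (f \<oplus>\<^bsub>?F\<^esub> g) = finsum P (\<lambda>s. (f \<oplus>\<^bsub>?F\<^esub> g) s \<odot>\<^bsub>P\<^esub> \<beta> s) ?B"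
      using f g by (intro h fg B) (auto simp: free_module_simps)
    also have "\<dots> = finsum P (\<lambda>s. f s \<odot>\<^bsub>P\<^esub> \<beta> s \<oplus>\<^bsub>P\<^esub> g s \<odot>\<^bsub>P\<^esub> \<beta> s) ?B"
    proof (rule P.finsum_cong')
      fix s assume "s \<in> ?B"
      then have "\<beta> s \<in> carrier P" using B(2) \<beta> by blast
      then show "(f \<oplus>\<^bsub>?F\<^esub> g) s \<odot>\<^bsub>P\<^esub> \<beta> s = f s \<odot>\<^bsub>P\<^esub> \<beta> s \<oplus>\<^bsub>P\<^esub> g s \<odot>\<^bsub>P\<^esub> \<beta> s"
        using f g by (simp add: free_module_simps P.smult_l_distr)
    qed (use summand[OF f B(2)] summand[OF g B(2)] in auto)
    also have "\<dots> = h f \<oplus>\<^bsub>P\<^esub> h g"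
      using summand[OF f B(2)] summand[OF g B(2)] h[OF f B] h[OF g B]
      by (subst P.finsum_addf) auto
    finally show "h (f \<oplus>\<^bsub>?F\<^esub> g) = h f \<oplus>\<^bsub>P\<^esub> h g" .
  next
    fix k f assume k: "k \<in> carrier R" and f: "f \<in> carrier ?F"
    let ?B = "{s. f s \<noteq> \<zero>}"
    have "h (k \<odot>\<^bsub>?F\<^esub> f) = finsum P (\<lambda>s. (k \<odot>\<^bsub>?F\<^esub> f) s \<odot>\<^bsub>P\<^esub> \<beta> s) ?B"
      using k f by (intro h F.smult_closed supp) (auto simp: free_module_simps)
    also have "\<dots> = finsum P (\<lambda>s. k \<odot>\<^bsub>P\<^esub> (f s \<odot>\<^bsub>P\<^esub> \<beta> s)) ?B"
    proof (rule P.finsum_cong')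
      fix s assume "s \<in> ?B"
      then have "\<beta> s \<in> carrier P" using supp(2)[OF f] \<beta> by blast
      then show "(k \<odot>\<^bsub>?F\<^esub> f) s \<odot>\<^bsub>P\<^esub> \<beta> s = k \<odot>\<^bsub>P\<^esub> (f s \<odot>\<^bsub>P\<^esub> \<beta> s)"
        using k f by (simp add: free_module_simps P.smult_assoc1)
    qed (use k summand[OF f supp(2)[OF f]] in auto)
    also have "\<dots> = k \<odot>\<^bsub>P\<^esub> h f"
      using P.finsum_smult_ldistr[OF supp(1)[OF f] k summand[OF f supp(2)[OF f]]]
        h[OF f supp[OF f] order_refl] by simp
    finally show "h (k \<odot>\<^bsub>?F\<^esub> f) = k \<odot>\<^bsub>P\<^esub> h f" .
  qed
  moreover have "h (free_gen R s) = \<beta> s" if "s \<in> S" for s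
  proof -
    have "h (free_gen R s) = finsum P (\<lambda>t. free_gen R s t \<odot>\<^bsub>P\<^esub> \<beta> t) {s}"
      using that by (intro h free_gen_closed) (auto simp: free_gen_def)
    also have "\<dots> = \<beta> s"
      using funcset_mem[OF \<beta> that] by (subst P.finsum_insert) (auto simp: free_gen_def)
    finally show ?thesis .
  qed
  ultimately show thesis by (rule that)
qed

end


section \<open>The universal property of the tensor product\<close>

lemma lin_maps_a_minus:
  assumes M: "module K M" and N: "module K N" and f: "f \<in> lin_maps K M N"
    and u: "u \<in> carrier M" and v: "v \<in> carrier M"
  shows "f (u \<ominus>\<^bsub>M\<^esub> v) = f u \<ominus>\<^bsub>N\<^esub> f v"
proof -
  interpret M: module K M by (fact M)
  interpret N: module K N by (fact N)
  have "\<ominus>\<^bsub>M\<^esub> v = (\<ominus>\<^bsub>K\<^esub> \<one>\<^bsub>K\<^esub>) \<odot>\<^bsub>M\<^esub> v" and "\<ominus>\<^bsub>N\<^esub> f v = (\<ominus>\<^bsub>K\<^esub> \<one>\<^bsub>K\<^esub>) \<odot>\<^bsub>N\<^esub> f v"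
    using v lin_mapsD(2)[OF f v] by (simp_all add: M.smult_l_minus N.smult_l_minus)
  then show ?thesis
    using u v by (simp add: a_minus_def lin_mapsD[OF f])
qed

lemma submodule_kernel:
  assumes M: "module K M" and N: "module K N" and f: "f \<in> lin_maps K M N"
  shows "submodule {u \<in> carrier M. f u = \<zero>\<^bsub>N\<^esub>} K M"
proof -
  interpret M: module K M by (fact M)
  interpret N: module K N by (fact N)
  note f_lin = lin_mapsD[OF f]
  show ?thesis
  proof (rule M.submoduleI)
    fix u assume u: "u \<in> {u \<in> carrier M. f u = \<zero>\<^bsub>N\<^esub>}"
    then show "\<ominus>\<^bsub>M\<^esub> u \<in> {u \<in> carrier M. f u = \<zero>\<^bsub>N\<^esub>}"
      using lin_maps_a_minus[OF M N f, of "\<zero>\<^bsub>M\<^esub>" u] lin_maps_zero[OF M N f]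
      by (simp add: a_minus_def)
  qed (auto simp: f_lin lin_maps_zero[OF M N f])
qed

context cring
begin

lemma tensor_rels_subset:
  assumes M: "module R M" and N: "module R N"
  shows "tensor_rels R M N \<subseteq> carrier (pair_module R M N)"
proof -
  interpret M: module R M by (fact M)
  interpret N: module R N by (fact N)
  interpret F: module R "pair_module R M N" by (rule free_module_module)
  have "free_gen R (u, w) \<in> carrier (pair_module R M N)"
    if "u \<in> carrier M" "w \<in> carrier N" for u w
    using that by (simp add: free_gen_closed)
  then show ?thesis
    unfolding tensor_rels_def by auto
qed

lemma tensor_relsI:
  shows "\<lbrakk>u \<in> carrier M; v \<in> carrier M; w \<in> carrier N\<rbrakk>
      \<Longrightarrow> free_gen R (u \<oplus>\<^bsub>M\<^esub> v, w) \<ominus>\<^bsub>pair_module R M N\<^esub> (free_gen R (u, w) \<oplus>\<^bsub>pair_module R M N\<^esub> free_gen R (v, w))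
        \<in> tensor_rels R M N"
    and "\<lbrakk>u \<in> carrier M; w \<in> carrier N; x \<in> carrier N\<rbrakk>
      \<Longrightarrow> free_gen R (u, w \<oplus>\<^bsub>N\<^esub> x) \<ominus>\<^bsub>pair_module R M N\<^esub> (free_gen R (u, w) \<oplus>\<^bsub>pair_module R M N\<^esub> free_gen R (u, x))
        \<in> tensor_rels R M N"
    and "\<lbrakk>k \<in> carrier R; u \<in> carrier M; w \<in> carrier N\<rbrakk>
      \<Longrightarrow> free_gen R (k \<odot>\<^bsub>M\<^esub> u, w) \<ominus>\<^bsub>pair_module R M N\<^esub> (k \<odot>\<^bsub>pair_module R M N\<^esub> free_gen R (u, w)) \<in> tensor_rels R M N"
    and "\<lbrakk>k \<in> carrier R; u \<in> carrier M; w \<in> carrier N\<rbrakk>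
      \<Longrightarrow> free_gen R (u, k \<odot>\<^bsub>N\<^esub> w) \<ominus>\<^bsub>pair_module R M N\<^esub> (k \<odot>\<^bsub>pair_module R M N\<^esub> free_gen R (u, w)) \<in> tensor_rels R M N"
  unfolding tensor_rels_def by blast+

lemmas tensor_kernel =
  submodule_span[OF free_module_module tensor_rels_subset, folded tensor_kernel_def]

lemma tensor_coset_linear:
  assumes M: "module R M" and N: "module R N"
  shows "(\<lambda>f\<in>carrier (pair_module R M N). tensor_kernel R M N +>\<^bsub>pair_module R M N\<^esub> f)
    \<in> lin_maps R (pair_module R M N) (tensor R M N)"
  unfolding tensor_def by (rule lin_maps_coset[OF free_module_module tensor_kernel(1)[OF M N]])

text \<open>
  Each defining relation of the tensor product has the form of a generator minus another element, and
  thus identifies an elementary tensor with the class of that element.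
\<close>

lemma tens_eqI:
  assumes M: "module R M" and N: "module R N" and u: "u \<in> carrier M" and w: "w \<in> carrier N"
    and f: "f \<in> carrier (pair_module R M N)"
    and rel: "free_gen R (u, w) \<ominus>\<^bsub>pair_module R M N\<^esub> f \<in> tensor_rels R M N"
  shows "tens R M N u w
    = (\<lambda>f\<in>carrier (pair_module R M N). tensor_kernel R M N +>\<^bsub>pair_module R M N\<^esub> f) f"
proof -
  have "tensor_kernel R M N +>\<^bsub>pair_module R M N\<^esub> free_gen R (u, w)
    = tensor_kernel R M N +>\<^bsub>pair_module R M N\<^esub> f"
    using rel tensor_kernel(2)[OF M N] f u w
    by (intro coset_eqI[OF free_module_module tensor_kernel(1)[OF M N]]) (auto simp: free_gen_closed)
  then show ?thesis
    using f by (simp add: tens_def)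
qed

lemma tens_coset:
  assumes "u \<in> carrier M" "w \<in> carrier N"
  shows "tens R M N u w = (\<lambda>f\<in>carrier (pair_module R M N).
    tensor_kernel R M N +>\<^bsub>pair_module R M N\<^esub> f) (free_gen R (u, w))"
  using assms by (simp add: tens_def free_gen_closed)

lemma tens_bilinear:
  assumes M: "module R M" and N: "module R N"
  shows tens_closed: "\<lbrakk>u \<in> carrier M; w \<in> carrier N\<rbrakk> \<Longrightarrow> tens R M N u w \<in> carrier (tensor R M N)"
    and tens_add_left: "\<lbrakk>u \<in> carrier M; v \<in> carrier M; w \<in> carrier N\<rbrakk>
      \<Longrightarrow> tens R M N (u \<oplus>\<^bsub>M\<^esub> v) w = tens R M N u w \<oplus>\<^bsub>tensor R M N\<^esub> tens R M N v w"
    and tens_add_right: "\<lbrakk>u \<in> carrier M; w \<in> carrier N; x \<in> carrier N\<rbrakk>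
      \<Longrightarrow> tens R M N u (w \<oplus>\<^bsub>N\<^esub> x) = tens R M N u w \<oplus>\<^bsub>tensor R M N\<^esub> tens R M N u x"
    and tens_smult_left: "\<lbrakk>k \<in> carrier R; u \<in> carrier M; w \<in> carrier N\<rbrakk>
      \<Longrightarrow> tens R M N (k \<odot>\<^bsub>M\<^esub> u) w = k \<odot>\<^bsub>tensor R M N\<^esub> tens R M N u w"
    and tens_smult_right: "\<lbrakk>k \<in> carrier R; u \<in> carrier M; w \<in> carrier N\<rbrakk>
      \<Longrightarrow> tens R M N u (k \<odot>\<^bsub>N\<^esub> w) = k \<odot>\<^bsub>tensor R M N\<^esub> tens R M N u w"
proof -
  interpret M: module R M by (fact M)
  interpret N: module R N by (fact N)
  interpret F: module R "pair_module R M N" by (rule free_module_module)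
  let ?\<pi> = "\<lambda>f\<in>carrier (pair_module R M N). tensor_kernel R M N +>\<^bsub>pair_module R M N\<^esub> f"
  note \<pi> = lin_mapsD[OF tensor_coset_linear[OF M N]]
  have gen: "free_gen R (u, w) \<in> carrier (pair_module R M N)"
    if "u \<in> carrier M" "w \<in> carrier N" for u w
    using that by (simp add: free_gen_closed)
  show "tens R M N u w \<in> carrier (tensor R M N)" if "u \<in> carrier M" "w \<in> carrier N"
    unfolding tens_coset[OF that] using that by (intro \<pi>(2) gen)
  {
    assume *: "u \<in> carrier M" "v \<in> carrier M" "w \<in> carrier N"
    have "tens R M N (u \<oplus>\<^bsub>M\<^esub> v) w
      = ?\<pi> (free_gen R (u, w) \<oplus>\<^bsub>pair_module R M N\<^esub> free_gen R (v, w))"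
      using * by (intro tens_eqI[OF M N]) (simp_all add: gen tensor_relsI)
    then show "tens R M N (u \<oplus>\<^bsub>M\<^esub> v) w = tens R M N u w \<oplus>\<^bsub>tensor R M N\<^esub> tens R M N v w"
      unfolding tens_coset[OF *(1,3)] tens_coset[OF *(2,3)] using * by (simp only: \<pi>(3) gen)
  next
    assume *: "u \<in> carrier M" "w \<in> carrier N" "x \<in> carrier N"
    have "tens R M N u (w \<oplus>\<^bsub>N\<^esub> x)
      = ?\<pi> (free_gen R (u, w) \<oplus>\<^bsub>pair_module R M N\<^esub> free_gen R (u, x))"
      using * by (intro tens_eqI[OF M N]) (simp_all add: gen tensor_relsI)
    then show "tens R M N u (w \<oplus>\<^bsub>N\<^esub> x) = tens R M N u w \<oplus>\<^bsub>tensor R M N\<^esub> tens R M N u x"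
      unfolding tens_coset[OF *(1,2)] tens_coset[OF *(1,3)] using * by (simp only: \<pi>(3) gen)
  next
    assume *: "k \<in> carrier R" "u \<in> carrier M" "w \<in> carrier N"
    have "tens R M N (k \<odot>\<^bsub>M\<^esub> u) w = ?\<pi> (k \<odot>\<^bsub>pair_module R M N\<^esub> free_gen R (u, w))"
      using * by (intro tens_eqI[OF M N]) (simp_all add: gen tensor_relsI)
    then show "tens R M N (k \<odot>\<^bsub>M\<^esub> u) w = k \<odot>\<^bsub>tensor R M N\<^esub> tens R M N u w"
      unfolding tens_coset[OF *(2,3)] using * by (simp only: \<pi>(4) gen)
    have "tens R M N u (k \<odot>\<^bsub>N\<^esub> w) = ?\<pi> (k \<odot>\<^bsub>pair_module R M N\<^esub> free_gen R (u, w))"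
      using * by (intro tens_eqI[OF M N]) (simp_all add: gen tensor_relsI)
    then show "tens R M N u (k \<odot>\<^bsub>N\<^esub> w) = k \<odot>\<^bsub>tensor R M N\<^esub> tens R M N u w"
      unfolding tens_coset[OF *(2,3)] using * by (simp only: \<pi>(4) gen)
  }
qed

text \<open>
  Elementary tensors generate: composed with the projection from the free module, both maps are
  determined by their values on the generators.
\<close>

lemma tensor_hom_eqI:
  assumes M: "module R M" and N: "module R N" and P: "module R P"
    and g: "g \<in> lin_maps R (tensor R M N) P" and h: "h \<in> lin_maps R (tensor R M N) P"
    and eq: "\<And>u w. \<lbrakk>u \<in> carrier M; w \<in> carrier N\<rbrakk> \<Longrightarrow> g (tens R M N u w) = h (tens R M N u w)"
  shows "g = h"
proof (rule lin_maps_ext[OF g h])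
  let ?F = "pair_module R M N"
  let ?\<pi> = "\<lambda>f\<in>carrier ?F. tensor_kernel R M N +>\<^bsub>?F\<^esub> f"
  note \<pi> = tensor_coset_linear[OF M N]
  have "compose (carrier ?F) g ?\<pi> = compose (carrier ?F) h ?\<pi>"
  proof (rule free_module_hom_eqI[OF P])
    show "compose (carrier ?F) g ?\<pi> \<in> lin_maps R ?F P" "compose (carrier ?F) h ?\<pi> \<in> lin_maps R ?F P"
      by (rule lin_maps_compose[OF free_module_module \<pi>], rule g h)+
    fix s assume s: "s \<in> carrier M \<times> carrier N"
    then have "g (?\<pi> (free_gen R s)) = h (?\<pi> (free_gen R s))"
      using eq tens_coset[of _ M _ N] by (cases s) (simp only: mem_Sigma_iff)
    then show "compose (carrier ?F) g ?\<pi> (free_gen R s) = compose (carrier ?F) h ?\<pi> (free_gen R s)"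
      by (simp only: compose_eq[OF free_gen_closed[OF s]])
  qed
  then have *: "g (?\<pi> f) = h (?\<pi> f)" if "f \<in> carrier ?F" for f
    unfolding fun_eq_iff using that by (auto simp only: compose_eq dest: spec[of _ f])
  fix U assume "U \<in> carrier (tensor R M N)"
  then obtain f where "f \<in> carrier ?F" "U = ?\<pi> f"
    by (auto simp: tensor_def quotient_module_def A_RCOSETS_def RCOSETS_def a_r_coset_def)
  then show "g U = h U" using * by blast
qed

text \<open>
  The linear extension of \<open>\<beta>\<close> to the free module on pairs kills each defining relation precisely by
  bilinearity. Its kernel is a submodule and so contains the span of the relations, whence the extension
  descends to the quotient.
\<close>

lemma tensor_lift:
  assumes M: "module R M" and N: "module R N" and P: "module R P"
    and closed: "\<And>u w. \<lbrakk>u \<in> carrier M; w \<in> carrier N\<rbrakk> \<Longrightarrow> \<beta> u w \<in> carrier P"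
    and add_left: "\<And>u v w. \<lbrakk>u \<in> carrier M; v \<in> carrier M; w \<in> carrier N\<rbrakk>
      \<Longrightarrow> \<beta> (u \<oplus>\<^bsub>M\<^esub> v) w = \<beta> u w \<oplus>\<^bsub>P\<^esub> \<beta> v w"
    and add_right: "\<And>u v w. \<lbrakk>u \<in> carrier M; v \<in> carrier N; w \<in> carrier N\<rbrakk>
      \<Longrightarrow> \<beta> u (v \<oplus>\<^bsub>N\<^esub> w) = \<beta> u v \<oplus>\<^bsub>P\<^esub> \<beta> u w"
    and smult_left: "\<And>k u w. \<lbrakk>k \<in> carrier R; u \<in> carrier M; w \<in> carrier N\<rbrakk>
      \<Longrightarrow> \<beta> (k \<odot>\<^bsub>M\<^esub> u) w = k \<odot>\<^bsub>P\<^esub> \<beta> u w"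
    and smult_right: "\<And>k u w. \<lbrakk>k \<in> carrier R; u \<in> carrier M; w \<in> carrier N\<rbrakk>
      \<Longrightarrow> \<beta> u (k \<odot>\<^bsub>N\<^esub> w) = k \<odot>\<^bsub>P\<^esub> \<beta> u w"
  obtains h where "h \<in> lin_maps R (tensor R M N) P"
    and "\<And>u w. \<lbrakk>u \<in> carrier M; w \<in> carrier N\<rbrakk> \<Longrightarrow> h (tens R M N u w) = \<beta> u w"
proof -
  interpret M: module R M by (fact M)
  interpret N: module R N by (fact N)
  interpret P: module R P by (fact P)
  let ?F = "pair_module R M N"
  interpret F: module R ?F by (rule free_module_module)
  have "(\<lambda>(u, w). \<beta> u w) \<in> carrier M \<times> carrier N \<rightarrow> carrier P"
    using closed by auto
  then obtain e where e: "e \<in> lin_maps R ?F P"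
    and "\<And>s. s \<in> carrier M \<times> carrier N \<Longrightarrow> e (free_gen R s) = (\<lambda>(u, w). \<beta> u w) s"
    by (rule free_module_lift[OF P]) blast
  then have e_gen: "e (free_gen R (u, w)) = \<beta> u w" if "u \<in> carrier M" "w \<in> carrier N" for u w
    using that by auto
  have gen: "free_gen R (u, w) \<in> carrier ?F" if "u \<in> carrier M" "w \<in> carrier N" for u w
    using that by (simp add: free_gen_closed)
  note e_lin = lin_mapsD[OF e] lin_maps_a_minus[OF free_module_module P e]
  have "x \<ominus>\<^bsub>P\<^esub> x = \<zero>\<^bsub>P\<^esub>" if "x \<in> carrier P" for x
    using that by (simp add: a_minus_def P.r_neg)
  then have "e f = \<zero>\<^bsub>P\<^esub>" if "f \<in> tensor_rels R M N" for f
    using that unfolding tensor_rels_def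
    by (elim UnE CollectE exE conjE)
      (simp_all add: e_lin e_gen gen closed add_left add_right smult_left smult_right)
  then have "tensor_rels R M N \<subseteq> {f \<in> carrier ?F. e f = \<zero>\<^bsub>P\<^esub>}"
    using tensor_rels_subset[OF M N] by blast
  then have "e f = \<zero>\<^bsub>P\<^esub>" if "f \<in> tensor_kernel R M N" for f
    using tensor_kernel(3)[OF M N submodule_kernel[OF free_module_module P e]] that by blast
  then obtain h where h: "h \<in> lin_maps R (tensor R M N) P"
    "\<And>f. f \<in> carrier ?F \<Longrightarrow> h (tensor_kernel R M N +>\<^bsub>?F\<^esub> f) = e f"
    using quotient_module_lift[OF free_module_module P tensor_kernel(1)[OF M N] e]
    unfolding tensor_def by metis
  show thesis
    by (rule that[OF h(1)]) (simp add: tens_def h(2) gen e_gen)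
qed

lemma free_module_singleton:
  assumes "a \<in> carrier (free_module R {s})"
  shows "a s \<in> carrier R" and "a s \<odot>\<^bsub>free_module R {s}\<^esub> free_gen R s = a"
  using assms by (auto simp: free_module_simps free_gen_def)

text \<open>
  Every \<open>a\<close> in a free module of rank one equals its coefficient times the generator, and the scalar can
  be moved out of the tensor product.
\<close>

lemma tensor_free_left_hom:
  assumes N: "module R N" and a: "a \<in> carrier (free_module R {s})" and n: "n \<in> carrier N"
    and h: "h \<in> lin_maps R (tensor R (free_module R {s}) N) P"
  shows "h (tens R (free_module R {s}) N a n)
    = a s \<odot>\<^bsub>P\<^esub> h (tens R (free_module R {s}) N (free_gen R s) n)"
proof -
  note t = tens_bilinear[OF free_module_module[of "{s}"] N]
  have "tens R (free_module R {s}) N (a s \<odot>\<^bsub>free_module R {s}\<^esub> free_gen R s) n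
    = a s \<odot>\<^bsub>tensor R (free_module R {s}) N\<^esub> tens R (free_module R {s}) N (free_gen R s) n"
    using n by (intro t(4)) (simp_all add: free_module_singleton[OF a] free_gen_closed)
  then show ?thesis
    using a n by (simp add: free_module_singleton[OF a] lin_mapsD[OF h] t(1) free_gen_closed)
qed

lemma tensor_free_right_hom:
  assumes M: "module R M" and a: "a \<in> carrier (free_module R {s})" and m: "m \<in> carrier M"
    and h: "h \<in> lin_maps R (tensor R M (free_module R {s})) P"
  shows "h (tens R M (free_module R {s}) m a)
    = a s \<odot>\<^bsub>P\<^esub> h (tens R M (free_module R {s}) m (free_gen R s))"
proof -
  note t = tens_bilinear[OF M free_module_module[of "{s}"]]
  have "tens R M (free_module R {s}) m (a s \<odot>\<^bsub>free_module R {s}\<^esub> free_gen R s)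
    = a s \<odot>\<^bsub>tensor R M (free_module R {s})\<^esub> tens R M (free_module R {s}) m (free_gen R s)"
    using m by (intro t(5)) (simp_all add: free_module_singleton[OF a] free_gen_closed)
  then show ?thesis
    using a m by (simp add: free_module_singleton[OF a] lin_mapsD[OF h] t(1) free_gen_closed)
qed

lemma tensor_free_left_restrict:
  assumes N: "module R N" and h: "h \<in> lin_maps R (tensor R (free_module R {s}) N) P"
  shows "(\<lambda>n\<in>carrier N. h (tens R (free_module R {s}) N (free_gen R s) n)) \<in> lin_maps R N P"
proof -
  interpret N: module R N by (fact N)
  show ?thesis
    by (rule lin_mapsI)
      (auto simp: tens_bilinear[OF free_module_module[of "{s}"] N] lin_mapsD[OF h] free_gen_closed)
qed

lemma tensor_free_right_restrict:
  assumes M: "module R M" and h: "h \<in> lin_maps R (tensor R M (free_module R {s})) P"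
  shows "(\<lambda>m\<in>carrier M. h (tens R M (free_module R {s}) m (free_gen R s))) \<in> lin_maps R M P"
proof -
  interpret M: module R M by (fact M)
  show ?thesis
    by (rule lin_mapsI)
      (auto simp: tens_bilinear[OF M free_module_module[of "{s}"]] lin_mapsD[OF h] free_gen_closed)
qed

text \<open>
  The bilinear map that corresponds to \<open>\<phi>\<close> under the isomorphism \<open>K \<otimes> N \<cong> N\<close>; it serves for both orders of the tensor
  factors.
\<close>

lemma coefficient_smult_bilinear:
  assumes P: "module R P" and \<phi>: "\<phi> \<in> lin_maps R N P"
  shows "\<lbrakk>a \<in> carrier (free_module R {s}); n \<in> carrier N\<rbrakk> \<Longrightarrow> a s \<odot>\<^bsub>P\<^esub> \<phi> n \<in> carrier P"
    and "\<lbrakk>a \<in> carrier (free_module R {s}); b \<in> carrier (free_module R {s}); n \<in> carrier N\<rbrakk>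
      \<Longrightarrow> (a \<oplus>\<^bsub>free_module R {s}\<^esub> b) s \<odot>\<^bsub>P\<^esub> \<phi> n = a s \<odot>\<^bsub>P\<^esub> \<phi> n \<oplus>\<^bsub>P\<^esub> b s \<odot>\<^bsub>P\<^esub> \<phi> n"
    and "\<lbrakk>a \<in> carrier (free_module R {s}); n \<in> carrier N; m \<in> carrier N\<rbrakk>
      \<Longrightarrow> a s \<odot>\<^bsub>P\<^esub> \<phi> (n \<oplus>\<^bsub>N\<^esub> m) = a s \<odot>\<^bsub>P\<^esub> \<phi> n \<oplus>\<^bsub>P\<^esub> a s \<odot>\<^bsub>P\<^esub> \<phi> m"
    and "\<lbrakk>k \<in> carrier R; a \<in> carrier (free_module R {s}); n \<in> carrier N\<rbrakk>
      \<Longrightarrow> (k \<odot>\<^bsub>free_module R {s}\<^esub> a) s \<odot>\<^bsub>P\<^esub> \<phi> n = k \<odot>\<^bsub>P\<^esub> (a s \<odot>\<^bsub>P\<^esub> \<phi> n)"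
    and "\<lbrakk>k \<in> carrier R; a \<in> carrier (free_module R {s}); n \<in> carrier N\<rbrakk>
      \<Longrightarrow> a s \<odot>\<^bsub>P\<^esub> \<phi> (k \<odot>\<^bsub>N\<^esub> n) = k \<odot>\<^bsub>P\<^esub> (a s \<odot>\<^bsub>P\<^esub> \<phi> n)"
proof -
  interpret P: module R P by (fact P)
  note \<phi>_lin = lin_mapsD(2-)[OF \<phi>]
  have coeff: "a s \<in> carrier R" if "a \<in> carrier (free_module R {s})" for a
    using that by (rule free_module_singleton)
  note c = coeff \<phi>_lin free_module_simps(2,4)
  show "\<lbrakk>a \<in> carrier (free_module R {s}); n \<in> carrier N\<rbrakk> \<Longrightarrow> a s \<odot>\<^bsub>P\<^esub> \<phi> n \<in> carrier P"
    by (simp add: c)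
  show "\<lbrakk>a \<in> carrier (free_module R {s}); b \<in> carrier (free_module R {s}); n \<in> carrier N\<rbrakk>
      \<Longrightarrow> (a \<oplus>\<^bsub>free_module R {s}\<^esub> b) s \<odot>\<^bsub>P\<^esub> \<phi> n = a s \<odot>\<^bsub>P\<^esub> \<phi> n \<oplus>\<^bsub>P\<^esub> b s \<odot>\<^bsub>P\<^esub> \<phi> n"
    by (simp add: c P.smult_l_distr)
  show "\<lbrakk>a \<in> carrier (free_module R {s}); n \<in> carrier N; m \<in> carrier N\<rbrakk>
      \<Longrightarrow> a s \<odot>\<^bsub>P\<^esub> \<phi> (n \<oplus>\<^bsub>N\<^esub> m) = a s \<odot>\<^bsub>P\<^esub> \<phi> n \<oplus>\<^bsub>P\<^esub> a s \<odot>\<^bsub>P\<^esub> \<phi> m"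
    by (simp add: c P.smult_r_distr)
  assume *: "k \<in> carrier R" "a \<in> carrier (free_module R {s})" "n \<in> carrier N"
  then show "(k \<odot>\<^bsub>free_module R {s}\<^esub> a) s \<odot>\<^bsub>P\<^esub> \<phi> n = k \<odot>\<^bsub>P\<^esub> (a s \<odot>\<^bsub>P\<^esub> \<phi> n)"
    by (simp add: c P.smult_assoc1)
  have "a s \<odot>\<^bsub>P\<^esub> \<phi> (k \<odot>\<^bsub>N\<^esub> n) = (a s \<otimes> k) \<odot>\<^bsub>P\<^esub> \<phi> n"
    using * by (simp add: c P.smult_assoc1)
  also have "a s \<otimes> k = k \<otimes> a s"
    using * by (simp add: coeff m_comm)
  finally show "a s \<odot>\<^bsub>P\<^esub> \<phi> (k \<odot>\<^bsub>N\<^esub> n) = k \<odot>\<^bsub>P\<^esub> (a s \<odot>\<^bsub>P\<^esub> \<phi> n)"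
    using * by (simp add: c P.smult_assoc1)
qed

lemma tensor_free_left_lift:
  assumes N: "module R N" and P: "module R P" and \<phi>: "\<phi> \<in> lin_maps R N P"
  obtains h where "h \<in> lin_maps R (tensor R (free_module R {s}) N) P"
    and "\<And>a n. \<lbrakk>a \<in> carrier (free_module R {s}); n \<in> carrier N\<rbrakk>
      \<Longrightarrow> h (tens R (free_module R {s}) N a n) = a s \<odot>\<^bsub>P\<^esub> \<phi> n"
  by (rule tensor_lift[OF free_module_module N P, of "{s}" "\<lambda>a n. a s \<odot>\<^bsub>P\<^esub> \<phi> n"];
    (rule that | rule coefficient_smult_bilinear[OF P \<phi>]); assumption)

lemma tensor_free_right_lift:
  assumes M: "module R M" and P: "module R P" and \<phi>: "\<phi> \<in> lin_maps R M P"
  obtains h where "h \<in> lin_maps R (tensor R M (free_module R {s})) P"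
    and "\<And>m a. \<lbrakk>m \<in> carrier M; a \<in> carrier (free_module R {s})\<rbrakk>
      \<Longrightarrow> h (tens R M (free_module R {s}) m a) = a s \<odot>\<^bsub>P\<^esub> \<phi> m"
  by (rule tensor_lift[OF M free_module_module P, of "{s}" "\<lambda>m a. a s \<odot>\<^bsub>P\<^esub> \<phi> m"];
    (rule that | rule coefficient_smult_bilinear[OF P \<phi>]); assumption)

end


section \<open>The Leech category and the algebra $\widetilde{K}X$\<close>

lemma leech_simps:
  "obj (leech X) = carrier X"
  "arr (leech X) x z = {y \<in> carrier X. x \<otimes>\<^bsub>X\<^esub> y = z}"
  "ide (leech X) x = \<one>\<^bsub>X\<^esub>"
  "cmp (leech X) x y z g f = f \<otimes>\<^bsub>X\<^esub> g"
  by (simp_all add: leech_def)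

lemma KX_simps:
  "gcomp (KX X K) x = free_module K {x}"
  "gone (KX X K) = free_gen K \<one>\<^bsub>X\<^esub>"
  by (simp_all add: KX_def)

context
  fixes X :: "('x, 's) monoid_scheme" and K :: "('k, 'r) ring_scheme"
  assumes X: "comm_monoid X" and K: "cring K"
begin

interpretation X: comm_monoid X by (fact X)
interpretation K: cring K by (fact K)

lemma category_leech: "category (leech X)"
  by unfold_locales (auto simp: leech_simps X.m_assoc)

lemma gen_closed: "free_gen K x \<in> carrier (free_module K {x})"
  by (simp add: K.free_gen_closed)

lemma gen_at: "free_gen K x x = \<one>\<^bsub>K\<^esub>"
  by (simp add: free_gen_def)

text \<open>
  The multiplication is defined by a definite description, so the values on elementary tensors can be
  read off only once existence and uniqueness are known. Existence is \<open>tensor_free_left_lift\<close>; uniqueness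
  holds because \<open>1\<^sub>x \<otimes> 1\<^sub>y\<close> generates the tensor product of two free modules of rank one.
\<close>

lemma KX_gmul:
  assumes x: "x \<in> carrier X" and y: "y \<in> carrier X"
  shows KX_gmul_linear: "gmul (KX X K) x y
      \<in> lin_maps K (tensor K (free_module K {x}) (free_module K {y})) (free_module K {x \<otimes>\<^bsub>X\<^esub> y})"
    and KX_gmul_tens: "\<lbrakk>a \<in> carrier (free_module K {x}); b \<in> carrier (free_module K {y})\<rbrakk>
      \<Longrightarrow> gmul (KX X K) x y (tens K (free_module K {x}) (free_module K {y}) a b)
        = (a x \<otimes>\<^bsub>K\<^esub> b y) \<odot>\<^bsub>free_module K {x \<otimes>\<^bsub>X\<^esub> y}\<^esub> free_gen K (x \<otimes>\<^bsub>X\<^esub> y)"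
proof -
  let ?A = "free_module K {x}" and ?B = "free_module K {y}" and ?C = "free_module K {x \<otimes>\<^bsub>X\<^esub> y}"
  let ?g = "free_gen K (x \<otimes>\<^bsub>X\<^esub> y)"
  interpret A: module K ?A by (rule K.free_module_module)
  interpret B: module K ?B by (rule K.free_module_module)
  interpret C: module K ?C by (rule K.free_module_module)
  \<comment> \<open>The property in the definite description that defines the multiplication.\<close>
  define Q where "Q h \<longleftrightarrow> h \<in> lin_maps K (tensor K ?A ?B) ?C
    \<and> h (tens K ?A ?B (free_gen K x) (free_gen K y)) = ?g" for h
  have Q_tens: "h (tens K ?A ?B a b) = a x \<odot>\<^bsub>?C\<^esub> (b y \<odot>\<^bsub>?C\<^esub> ?g)"
    if h: "Q h" and a: "a \<in> carrier ?A" and b: "b \<in> carrier ?B" for h a b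
  proof -
    have h_lin: "h \<in> lin_maps K (tensor K ?A ?B) ?C"
      and h_gen: "h (tens K ?A ?B (free_gen K x) (free_gen K y)) = ?g"
      using h by (simp_all add: Q_def)
    show ?thesis
      unfolding K.tensor_free_left_hom[OF B.module_axioms a b h_lin]
        K.tensor_free_right_hom[OF A.module_axioms b gen_closed h_lin] h_gen ..
  qed
  have "(\<lambda>_. ?g) \<in> {y} \<rightarrow> carrier ?C"
    using gen_closed by simp
  then obtain \<phi> where \<phi>: "\<phi> \<in> lin_maps K ?B ?C" "\<phi> (free_gen K y) = ?g"
    by (rule K.free_module_lift[OF C.module_axioms]) simp
  obtain h where "h \<in> lin_maps K (tensor K ?A ?B) ?C"
    "\<And>a b. \<lbrakk>a \<in> carrier ?A; b \<in> carrier ?B\<rbrakk> \<Longrightarrow> h (tens K ?A ?B a b) = a x \<odot>\<^bsub>?C\<^esub> \<phi> b"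
    using K.tensor_free_left_lift[OF B.module_axioms C.module_axioms \<phi>(1), of x] by metis
  then have "Q h"
    by (simp add: Q_def gen_closed \<phi>(2) gen_at)
  moreover have "h' = h" if "Q h'" for h'
    using that \<open>Q h\<close> Q_tens
    by (intro K.tensor_hom_eqI[OF A.module_axioms B.module_axioms C.module_axioms])
      (simp_all add: Q_def)
  moreover have "gmul (KX X K) x y = The Q"
    by (simp add: KX_def Q_def[abs_def])
  ultimately have "Q (gmul (KX X K) x y)"
    by (metis theI)
  then show "gmul (KX X K) x y \<in> lin_maps K (tensor K ?A ?B) ?C"
    by (simp add: Q_def)
  show "gmul (KX X K) x y (tens K ?A ?B a b) = (a x \<otimes>\<^bsub>K\<^esub> b y) \<odot>\<^bsub>?C\<^esub> ?g"
    if a: "a \<in> carrier ?A" and b: "b \<in> carrier ?B"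
    unfolding Q_tens[OF \<open>Q (gmul (KX X K) x y)\<close> a b]
    by (rule C.smult_assoc1[symmetric])
      (rule K.free_module_singleton(1)[OF a] K.free_module_singleton(1)[OF b] gen_closed)+
qed

lemma KX_gmul_closed:
  assumes "x \<in> carrier X" "y \<in> carrier X"
    and a: "a \<in> carrier (free_module K {x})" and b: "b \<in> carrier (free_module K {y})"
  shows "gmul (KX X K) x y (tens K (free_module K {x}) (free_module K {y}) a b)
    \<in> carrier (free_module K {x \<otimes>\<^bsub>X\<^esub> y})"
  using K.tens_closed[OF K.free_module_module K.free_module_module a b]
  by (rule lin_mapsD(2)[OF KX_gmul_linear[OF assms(1,2)]])

lemma KX_gmul_coefficient:
  assumes "x \<in> carrier X" "y \<in> carrier X"
    and a: "a \<in> carrier (free_module K {x})" and b: "b \<in> carrier (free_module K {y})"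
  shows "gmul (KX X K) x y (tens K (free_module K {x}) (free_module K {y}) a b) (x \<otimes>\<^bsub>X\<^esub> y)
    = a x \<otimes>\<^bsub>K\<^esub> b y"
  unfolding KX_gmul_tens[OF assms]
  using K.free_module_singleton(1)[OF a] K.free_module_singleton(1)[OF b]
  by (simp add: free_module_simps(4) gen_at)

lemma KX_gmul_gen:
  assumes "x \<in> carrier X" "y \<in> carrier X"
  shows "gmul (KX X K) x y (tens K (free_module K {x}) (free_module K {y}) (free_gen K x) (free_gen K y))
    = free_gen K (x \<otimes>\<^bsub>X\<^esub> y)"
proof -
  interpret C: module K "free_module K {x \<otimes>\<^bsub>X\<^esub> y}" by (rule K.free_module_module)
  show ?thesis
    by (simp add: KX_gmul_tens[OF assms] gen_closed gen_at)
qed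

lemma graded_algebra_KX: "graded_algebra X K (KX X K)"
proof (intro graded_algebra.intro graded_algebra_axioms.intro X K; unfold KX_simps)
  fix x y z a b c
  assume x: "x \<in> carrier X" and y: "y \<in> carrier X" and z: "z \<in> carrier X"
    and a: "a \<in> carrier (free_module K {x})" and b: "b \<in> carrier (free_module K {y})"
    and c: "c \<in> carrier (free_module K {z})"
  note xy = X.m_closed[OF x y] and yz = X.m_closed[OF y z]
  note ab = KX_gmul_closed[OF x y a b] and bc = KX_gmul_closed[OF y z b c]
  show "gmul (KX X K) (x \<otimes>\<^bsub>X\<^esub> y) z (tens K (free_module K {x \<otimes>\<^bsub>X\<^esub> y}) (free_module K {z})
          (gmul (KX X K) x y (tens K (free_module K {x}) (free_module K {y}) a b)) c)
      = gmul (KX X K) x (y \<otimes>\<^bsub>X\<^esub> z) (tens K (free_module K {x}) (free_module K {y \<otimes>\<^bsub>X\<^esub> z}) a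
          (gmul (KX X K) y z (tens K (free_module K {y}) (free_module K {z}) b c)))"
    unfolding KX_gmul_tens[OF xy z ab c] KX_gmul_tens[OF x yz a bc]
      KX_gmul_coefficient[OF x y a b] KX_gmul_coefficient[OF y z b c]
    using K.free_module_singleton(1)[OF a] K.free_module_singleton(1)[OF b]
      K.free_module_singleton(1)[OF c] x y z
    by (simp add: K.m_assoc X.m_assoc)
next
  fix x a assume x: "x \<in> carrier X" and a: "a \<in> carrier (free_module K {x})"
  show "gmul (KX X K) \<one>\<^bsub>X\<^esub> x (tens K (free_module K {\<one>\<^bsub>X\<^esub>}) (free_module K {x})
      (free_gen K \<one>\<^bsub>X\<^esub>) a) = a"
    unfolding KX_gmul_tens[OF X.one_closed x gen_closed a]
    using x K.free_module_singleton[OF a] by (simp add: gen_at)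
  show "gmul (KX X K) x \<one>\<^bsub>X\<^esub> (tens K (free_module K {x}) (free_module K {\<one>\<^bsub>X\<^esub>}) a
      (free_gen K \<one>\<^bsub>X\<^esub>)) = a"
    unfolding KX_gmul_tens[OF x X.one_closed a gen_closed]
    using x K.free_module_singleton[OF a] by (simp add: gen_at)
qed (simp_all add: K.free_module_module KX_gmul_linear gen_closed)


section \<open>Left modules are covariant functors\<close>

lemma left_canonical_simps:
  "omap (omap (left_canonical X K) N) = lcomp N"
  "amap (omap (left_canonical X K) N) x z y = (\<lambda>n\<in>carrier (lcomp N x).
    lact N y x (tens K (free_module K {y}) (lcomp N x) (free_gen K y) n))"
  by (simp_all add: left_canonical_def KX_simps)

text \<open>
  The whole action is recovered from the action of the generators, that is, from the associated
  functor.
\<close>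

lemma left_action_by_generator:
  assumes N: "left_module X K (KX X K) N" and x: "x \<in> carrier X" and y: "y \<in> carrier X"
    and a: "a \<in> carrier (free_module K {y})" and n: "n \<in> carrier (lcomp N x)"
  shows "lact N y x (tens K (free_module K {y}) (lcomp N x) a n)
    = a y \<odot>\<^bsub>lcomp N (x \<otimes>\<^bsub>X\<^esub> y)\<^esub> amap (omap (left_canonical X K) N) x (x \<otimes>\<^bsub>X\<^esub> y) y n"
proof -
  interpret N: left_module X K "KX X K" N by (fact N)
  show ?thesis
    using K.tensor_free_left_hom[OF N.lcomp_module[OF x] a n N.lact_linear[OF x y, unfolded KX_simps]] n
    by (simp add: left_canonical_simps)
qed

lemma left_generator_linear:
  assumes N: "left_module X K (KX X K) N" and x: "x \<in> carrier X" and y: "y \<in> carrier X"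
  shows "amap (omap (left_canonical X K) N) x (x \<otimes>\<^bsub>X\<^esub> y) y
    \<in> lin_maps K (lcomp N x) (lcomp N (x \<otimes>\<^bsub>X\<^esub> y))"
proof -
  interpret N: left_module X K "KX X K" N by (fact N)
  show ?thesis
    unfolding left_canonical_simps
    by (rule K.tensor_free_left_restrict[OF N.lcomp_module[OF x] N.lact_linear[OF x y, unfolded KX_simps]])
qed

lemma left_canonical_functor:
  assumes N: "left_module X K (KX X K) N"
  shows "cat_functor (leech X) (mod_cat K) (omap (left_canonical X K) N)"
proof -
  interpret N: left_module X K "KX X K" N by (fact N)
  interpret leech: category "leech X" by (rule category_leech)
  interpret mod_cat: category "mod_cat K" by (rule category_mod_cat)
  let ?F = "omap (left_canonical X K) N"
  show ?thesis
  proof (unfold_locales, goal_cases)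
    case (1 x)
    then show ?case
      by (simp add: leech_simps mod_cat_simps left_canonical_simps N.lcomp_module)
  next
    case (2 x z y)
    then show ?case
      using left_generator_linear[OF N, of x y]
      by (auto simp: leech_simps mod_cat_simps left_canonical_simps(1))
  next
    case (3 x)
    then have x: "x \<in> carrier X" by (simp add: leech_simps)
    show ?case
      using N.lact_one[OF x]
      by (auto simp: leech_simps mod_cat_simps left_canonical_simps KX_simps intro!: restrict_ext)
  next
    case (4 x z w y v)
    then have x: "x \<in> carrier X" and y: "y \<in> carrier X" and v: "v \<in> carrier X"
      and z: "z = x \<otimes>\<^bsub>X\<^esub> y" and w: "w = x \<otimes>\<^bsub>X\<^esub> y \<otimes>\<^bsub>X\<^esub> v"
      by (auto simp: leech_simps)
    have "amap ?F x w (y \<otimes>\<^bsub>X\<^esub> v) n = amap ?F z w v (amap ?F x z y n)"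
      if n: "n \<in> carrier (lcomp N x)" for n
      using N.lact_assoc[OF x y v n, of "free_gen K v" "free_gen K y"]
        lin_mapsD(2)[OF left_generator_linear[OF N x y] n] n
      by (simp add: KX_simps gen_closed KX_gmul_gen[OF v y] left_canonical_simps z X.m_comm[OF v y])
    moreover have "amap ?F x w (y \<otimes>\<^bsub>X\<^esub> v) \<in> extensional (carrier (lcomp N x))"
      by (simp add: left_canonical_simps)
    ultimately show ?case
      by (auto simp: leech_simps mod_cat_simps left_canonical_simps(1) compose_def
          intro!: extensionalityI[of _ "carrier (lcomp N x)"])
  qed
qed

text \<open>
  Naturality is equivariance for the generators \<open>1\<^sub>y\<close>, and equivariance for all scalar multiples
  follows by linearity of the components.
\<close>

lemma lmod_maps_eq_nat_trans:
  assumes N: "left_module X K (KX X K) N" and N': "left_module X K (KX X K) N'"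
  shows "lmod_maps X K (KX X K) N N' = nat_trans (leech X) (mod_cat K)
    (omap (left_canonical X K) N) (omap (left_canonical X K) N')"
proof -
  interpret N: left_module X K "KX X K" N by (fact N)
  interpret N': left_module X K "KX X K" N' by (fact N')
  let ?F = "omap (left_canonical X K) N" and ?F' = "omap (left_canonical X K) N'"
  have "(\<forall>a\<in>carrier (free_module K {y}). \<forall>n\<in>carrier (lcomp N x).
        f (x \<otimes>\<^bsub>X\<^esub> y) (lact N y x (tens K (free_module K {y}) (lcomp N x) a n))
        = lact N' y x (tens K (free_module K {y}) (lcomp N' x) a (f x n)))
      \<longleftrightarrow> compose (carrier (lcomp N x)) (f (x \<otimes>\<^bsub>X\<^esub> y)) (amap ?F x (x \<otimes>\<^bsub>X\<^esub> y) y)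
        = compose (carrier (lcomp N x)) (amap ?F' x (x \<otimes>\<^bsub>X\<^esub> y) y) (f x)"
    (is "?L \<longleftrightarrow> ?R")
    if x: "x \<in> carrier X" and y: "y \<in> carrier X"
      and f: "f \<in> (\<Pi>\<^sub>E x\<in>carrier X. lin_maps K (lcomp N x) (lcomp N' x))" for x y f
  proof -
    have fx: "f x \<in> lin_maps K (lcomp N x) (lcomp N' x)"
      and fxy: "f (x \<otimes>\<^bsub>X\<^esub> y) \<in> lin_maps K (lcomp N (x \<otimes>\<^bsub>X\<^esub> y)) (lcomp N' (x \<otimes>\<^bsub>X\<^esub> y))"
      using f x y by auto
    have pointwise: "?R \<longleftrightarrow> (\<forall>n\<in>carrier (lcomp N x).
        f (x \<otimes>\<^bsub>X\<^esub> y) (amap ?F x (x \<otimes>\<^bsub>X\<^esub> y) y n) = amap ?F' x (x \<otimes>\<^bsub>X\<^esub> y) y (f x n))"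
    proof (intro iffI ballI)
      fix n assume ?R and "n \<in> carrier (lcomp N x)"
      from fun_cong[OF this(1), of n] this(2)
      show "f (x \<otimes>\<^bsub>X\<^esub> y) (amap ?F x (x \<otimes>\<^bsub>X\<^esub> y) y n) = amap ?F' x (x \<otimes>\<^bsub>X\<^esub> y) y (f x n)"
        by (simp only: compose_eq)
    qed (simp add: compose_def cong: restrict_cong)
    show ?thesis
      unfolding pointwise
    proof (intro iffI ballI)
      fix n assume L: ?L and n: "n \<in> carrier (lcomp N x)"
      have "f (x \<otimes>\<^bsub>X\<^esub> y) (lact N y x (tens K (free_module K {y}) (lcomp N x) (free_gen K y) n))
        = lact N' y x (tens K (free_module K {y}) (lcomp N' x) (free_gen K y) (f x n))"
        by (rule L[rule_format, OF gen_closed n])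
      then show "f (x \<otimes>\<^bsub>X\<^esub> y) (amap ?F x (x \<otimes>\<^bsub>X\<^esub> y) y n) = amap ?F' x (x \<otimes>\<^bsub>X\<^esub> y) y (f x n)"
        using n lin_mapsD(2)[OF fx n] by (simp add: left_canonical_simps)
    next
      fix a n
      assume R: "\<forall>n\<in>carrier (lcomp N x).
          f (x \<otimes>\<^bsub>X\<^esub> y) (amap ?F x (x \<otimes>\<^bsub>X\<^esub> y) y n) = amap ?F' x (x \<otimes>\<^bsub>X\<^esub> y) y (f x n)"
        and a: "a \<in> carrier (free_module K {y})" and n: "n \<in> carrier (lcomp N x)"
      show "f (x \<otimes>\<^bsub>X\<^esub> y) (lact N y x (tens K (free_module K {y}) (lcomp N x) a n))
        = lact N' y x (tens K (free_module K {y}) (lcomp N' x) a (f x n))"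
        unfolding left_action_by_generator[OF N x y a n]
          left_action_by_generator[OF N' x y a lin_mapsD(2)[OF fx n]]
          lin_mapsD(4)[OF fxy K.free_module_singleton(1)[OF a]
            lin_mapsD(2)[OF left_generator_linear[OF N x y] n]]
        using R n by simp
    qed
  qed
  note equivariant_iff = this
  show ?thesis
  proof (rule Set.set_eqI)
    fix f
    let ?P = "f \<in> (\<Pi>\<^sub>E x\<in>carrier X. lin_maps K (lcomp N x) (lcomp N' x))"
    have "f \<in> nat_trans (leech X) (mod_cat K) ?F ?F' \<longleftrightarrow> ?P \<and>
        (\<forall>x\<in>carrier X. \<forall>y\<in>carrier X.
          compose (carrier (lcomp N x)) (f (x \<otimes>\<^bsub>X\<^esub> y)) (amap ?F x (x \<otimes>\<^bsub>X\<^esub> y) y)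
          = compose (carrier (lcomp N x)) (amap ?F' x (x \<otimes>\<^bsub>X\<^esub> y) y) (f x))"
      unfolding nat_trans_def leech_simps mod_cat_simps left_canonical_simps(1) by blast
    also have "\<dots> \<longleftrightarrow> f \<in> lmod_maps X K (KX X K) N N'"
      unfolding lmod_maps_def KX_simps mem_Collect_eq using equivariant_iff[of _ _ f]
      by (intro conj_cong refl ball_cong) (simp only:)
    finally show "f \<in> lmod_maps X K (KX X K) N N' \<longleftrightarrow> f \<in> nat_trans (leech X) (mod_cat K) ?F ?F'"
      ..
  qed
qed

text \<open>
  The action \<open>a \<otimes> n \<mapsto> a(y) \<cdot> T(y)(n)\<close> turns the values of the functor into a left module. Its associated
  functor agrees with \<open>T\<close> on objects and arrows, although not necessarily as a record.
\<close>

lemma functor_to_left_module: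
  fixes T :: "('x, 'x, ('k, 'v) module, 'v \<Rightarrow> 'v) cfunctor"
  assumes T: "cat_functor (leech X) (mod_cat K) T"
  obtains N where "left_module X K (KX X K) N"
    and "isomorphic_in (functor_cat (leech X) (mod_cat K)) (omap (left_canonical X K) N) T"
proof -
  interpret T: cat_functor "leech X" "mod_cat K" T by (fact T)
  have T_module: "module K (omap T x)" if "x \<in> carrier X" for x
    using T.omap_closed[of x] that by (simp add: leech_simps mod_cat_simps)
  have T_linear: "amap T x (x \<otimes>\<^bsub>X\<^esub> y) y \<in> lin_maps K (omap T x) (omap T (x \<otimes>\<^bsub>X\<^esub> y))"
    if "x \<in> carrier X" "y \<in> carrier X" for x y
    using T.amap_closed[of x "x \<otimes>\<^bsub>X\<^esub> y" y] that by (simp add: leech_simps mod_cat_simps)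
  \<comment> \<open>Elements of the tensor product are cosets, so the map is chosen by its values on elementary tensors.\<close>
  define is_act where "is_act x y h \<longleftrightarrow>
      h \<in> lin_maps K (tensor K (free_module K {y}) (omap T x)) (omap T (x \<otimes>\<^bsub>X\<^esub> y)) \<and>
      (\<forall>a\<in>carrier (free_module K {y}). \<forall>n\<in>carrier (omap T x).
        h (tens K (free_module K {y}) (omap T x) a n)
        = a y \<odot>\<^bsub>omap T (x \<otimes>\<^bsub>X\<^esub> y)\<^esub> amap T x (x \<otimes>\<^bsub>X\<^esub> y) y n)" for x y h
  define act where "act y x = (SOME h. is_act x y h)" for y x
  have act: "is_act x y (act y x)" if x: "x \<in> carrier X" and y: "y \<in> carrier X" for x y
  proof -
    have "\<exists>h. is_act x y h"
      by (rule K.tensor_free_left_lift[OF T_module[OF x] T_module[OF X.m_closed[OF x y]]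
            T_linear[OF x y], of y]) (auto simp: is_act_def)
    then show ?thesis
      unfolding act_def by (rule someI_ex)
  qed
  then have act_tens: "act y x (tens K (free_module K {y}) (omap T x) a n)
      = a y \<odot>\<^bsub>omap T (x \<otimes>\<^bsub>X\<^esub> y)\<^esub> amap T x (x \<otimes>\<^bsub>X\<^esub> y) y n"
    if "x \<in> carrier X" "y \<in> carrier X" "a \<in> carrier (free_module K {y})" "n \<in> carrier (omap T x)"
    for x y a n
    using that by (simp add: is_act_def)
  let ?N = "\<lparr>lcomp = omap T, lact = act\<rparr>"
  have N: "left_module X K (KX X K) ?N"
  proof (intro left_module.intro graded_algebra_KX left_module_axioms.intro;
      unfold KX_simps lmod.simps)
    fix x n assume x: "x \<in> carrier X" and n: "n \<in> carrier (omap T x)"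
    interpret Tx: module K "omap T x" by (rule T_module[OF x])
    show "act \<one>\<^bsub>X\<^esub> x (tens K (free_module K {\<one>\<^bsub>X\<^esub>}) (omap T x) (free_gen K \<one>\<^bsub>X\<^esub>) n) = n"
      using T.amap_ide[of x] x n
      by (simp add: act_tens gen_closed gen_at leech_simps mod_cat_simps)
  next
    fix x y z n a b
    assume x: "x \<in> carrier X" and y: "y \<in> carrier X" and z: "z \<in> carrier X"
      and n: "n \<in> carrier (omap T x)"
      and a: "a \<in> carrier (free_module K {z})" and b: "b \<in> carrier (free_module K {y})"
    note xy = X.m_closed[OF x y] and zy = X.m_closed[OF z y]
    have assoc: "x \<otimes>\<^bsub>X\<^esub> (z \<otimes>\<^bsub>X\<^esub> y) = x \<otimes>\<^bsub>X\<^esub> y \<otimes>\<^bsub>X\<^esub> z"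
      using x y z by (simp add: X.m_ac)
    let ?w = "x \<otimes>\<^bsub>X\<^esub> y \<otimes>\<^bsub>X\<^esub> z"
    interpret Txy: module K "omap T (x \<otimes>\<^bsub>X\<^esub> y)" by (rule T_module[OF xy])
    interpret Tw: module K "omap T ?w" by (rule T_module[OF X.m_closed[OF xy z]])
    note Txy_n = lin_mapsD(2)[OF T_linear[OF x y] n]
    note T_z = lin_mapsD[OF T_linear[OF xy z]]
    note coeff = K.free_module_singleton(1)[OF a] K.free_module_singleton(1)[OF b]
    have "amap T x ?w (z \<otimes>\<^bsub>X\<^esub> y) = compose (carrier (omap T x))
        (amap T (x \<otimes>\<^bsub>X\<^esub> y) ?w z) (amap T x (x \<otimes>\<^bsub>X\<^esub> y) y)"
      using T.amap_cmp[of x "x \<otimes>\<^bsub>X\<^esub> y" ?w y z] x y z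
      by (simp add: leech_simps mod_cat_simps X.m_comm[of z y])
    then have T_zy: "amap T x ?w (z \<otimes>\<^bsub>X\<^esub> y) n
        = amap T (x \<otimes>\<^bsub>X\<^esub> y) ?w z (amap T x (x \<otimes>\<^bsub>X\<^esub> y) y n)"
      using n by (simp add: compose_eq)
    have "act z (x \<otimes>\<^bsub>X\<^esub> y) (tens K (free_module K {z}) (omap T (x \<otimes>\<^bsub>X\<^esub> y)) a
          (act y x (tens K (free_module K {y}) (omap T x) b n)))
      = a z \<odot>\<^bsub>omap T ?w\<^esub> (b y \<odot>\<^bsub>omap T ?w\<^esub>
          amap T (x \<otimes>\<^bsub>X\<^esub> y) ?w z (amap T x (x \<otimes>\<^bsub>X\<^esub> y) y n))"
      using Txy_n coeff by (simp add: act_tens x y z a b n T_z)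
    also have "\<dots> = (a z \<otimes>\<^bsub>K\<^esub> b y) \<odot>\<^bsub>omap T ?w\<^esub> amap T x ?w (z \<otimes>\<^bsub>X\<^esub> y) n"
      using Txy_n coeff by (simp add: T_zy T_z Tw.smult_assoc1)
    also have "\<dots> = act (z \<otimes>\<^bsub>X\<^esub> y) x (tens K (free_module K {z \<otimes>\<^bsub>X\<^esub> y}) (omap T x)
          (gmul (KX X K) z y (tens K (free_module K {z}) (free_module K {y}) a b)) n)"
      unfolding act_tens[OF x zy KX_gmul_closed[OF z y a b] n] KX_gmul_coefficient[OF z y a b] assoc ..
    finally show "act z (x \<otimes>\<^bsub>X\<^esub> y) (tens K (free_module K {z}) (omap T (x \<otimes>\<^bsub>X\<^esub> y)) a
          (act y x (tens K (free_module K {y}) (omap T x) b n)))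
      = act (z \<otimes>\<^bsub>X\<^esub> y) x (tens K (free_module K {z \<otimes>\<^bsub>X\<^esub> y}) (omap T x)
          (gmul (KX X K) z y (tens K (free_module K {z}) (free_module K {y}) a b)) n)" .
  qed (use T_module act in \<open>auto simp: is_act_def\<close>)
  have "isomorphic_in (functor_cat (leech X) (mod_cat K)) (omap (left_canonical X K) ?N) T"
  proof (rule isomorphic_in_functor_cat[OF left_canonical_functor[OF N] T])
    fix x z y assume "x \<in> obj (leech X)" "z \<in> obj (leech X)" and "y \<in> arr (leech X) x z"
    then have x: "x \<in> carrier X" and y: "y \<in> carrier X" and z: "z = x \<otimes>\<^bsub>X\<^esub> y"
      by (auto simp: leech_simps)
    interpret Tz: module K "omap T (x \<otimes>\<^bsub>X\<^esub> y)" using T_module x y by simp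
    have "amap (omap (left_canonical X K) ?N) x z y n = amap T x z y n"
      if "n \<in> carrier (omap T x)" for n
      using that x y lin_mapsD(2)[OF T_linear[OF x y] that]
      by (simp add: left_canonical_simps act_tens gen_closed gen_at z)
    then show "amap (omap (left_canonical X K) ?N) x z y = amap T x z y"
      using lin_mapsD(1)[OF T_linear[OF x y]] unfolding z
      by (intro extensionalityI[of _ "carrier (omap T x)"]) (auto simp: left_canonical_simps PiE_iff)
  qed (simp add: left_canonical_simps)
  with N show thesis by (rule that)
qed

lemma left_canonical_equivalence:
  "equivalence_of_categories (lmod_cat X K (KX X K))
    (functor_cat (leech X) (mod_cat K :: (('k, 'v) module, 'v \<Rightarrow> 'v) cat)) (left_canonical X K)"
proof -
  have "equivalence_of_categories (lmod_cat X K (KX X K))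
    (functor_cat (leech X) (mod_cat K :: (('k, 'v) module, 'v \<Rightarrow> 'v) cat))
    \<lparr>omap = omap (left_canonical X K), amap = (\<lambda>N N' f. f)\<rparr>"
  proof (rule equivalence_by_hom_identification)
    show "category (functor_cat (leech X) (mod_cat K :: (('k, 'v) module, 'v \<Rightarrow> 'v) cat))"
      by (rule category_functor_cat[OF category_leech category_mod_cat])
  next
    fix T :: "('x, 'x, ('k, 'v) module, 'v \<Rightarrow> 'v) cfunctor"
    assume "T \<in> obj (functor_cat (leech X) (mod_cat K))"
    then show "\<exists>N\<in>obj (lmod_cat X K (KX X K)).
        isomorphic_in (functor_cat (leech X) (mod_cat K)) (omap (left_canonical X K) N) T"
      by (auto simp: functor_cat_simps lmod_cat_def elim: functor_to_left_module)
  qed (auto simp: lmod_cat_def functor_cat_simps leech_simps mod_cat_simps left_canonical_simps(1)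
      left_canonical_functor lmod_maps_eq_nat_trans)
  then show ?thesis
    by (simp add: left_canonical_def)
qed

section \<open>Right modules are contravariant functors\<close>

lemma right_canonical_simps:
  "omap (omap (right_canonical X K) M) = rcomp M"
  "amap (omap (right_canonical X K) M) z x y = (\<lambda>m\<in>carrier (rcomp M z).
    ract M x y (tens K (rcomp M z) (free_module K {y}) m (free_gen K y)))"
  by (simp_all add: right_canonical_def KX_simps)

lemma right_action_by_generator:
  assumes M: "right_module X K (KX X K) M" and x: "x \<in> carrier X" and y: "y \<in> carrier X"
    and m: "m \<in> carrier (rcomp M (x \<otimes>\<^bsub>X\<^esub> y))" and a: "a \<in> carrier (free_module K {y})"
  shows "ract M x y (tens K (rcomp M (x \<otimes>\<^bsub>X\<^esub> y)) (free_module K {y}) m a)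
    = a y \<odot>\<^bsub>rcomp M x\<^esub> amap (omap (right_canonical X K) M) (x \<otimes>\<^bsub>X\<^esub> y) x y m"
proof -
  interpret M: right_module X K "KX X K" M by (fact M)
  show ?thesis
    using K.tensor_free_right_hom[OF M.rcomp_module[OF X.m_closed[OF x y]] a m
        M.ract_linear[OF x y, unfolded KX_simps]] m
    by (simp add: right_canonical_simps)
qed

lemma right_generator_linear:
  assumes M: "right_module X K (KX X K) M" and x: "x \<in> carrier X" and y: "y \<in> carrier X"
  shows "amap (omap (right_canonical X K) M) (x \<otimes>\<^bsub>X\<^esub> y) x y
    \<in> lin_maps K (rcomp M (x \<otimes>\<^bsub>X\<^esub> y)) (rcomp M x)"
proof -
  interpret M: right_module X K "KX X K" M by (fact M)
  show ?thesis
    unfolding right_canonical_simps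
    by (rule K.tensor_free_right_restrict[OF M.rcomp_module[OF X.m_closed[OF x y]]
          M.ract_linear[OF x y, unfolded KX_simps]])
qed

lemma right_canonical_functor:
  assumes M: "right_module X K (KX X K) M"
  shows "cat_functor (op_cat (leech X)) (mod_cat K) (omap (right_canonical X K) M)"
proof -
  interpret M: right_module X K "KX X K" M by (fact M)
  interpret leech: category "op_cat (leech X)" by (rule category_op_cat[OF category_leech])
  interpret mod_cat: category "mod_cat K" by (rule category_mod_cat)
  let ?F = "omap (right_canonical X K) M"
  show ?thesis
  proof (unfold_locales, goal_cases)
    case (1 x)
    then show ?case
      by (simp add: op_cat_simps leech_simps mod_cat_simps right_canonical_simps M.rcomp_module)
  next
    case (2 z x y)
    then show ?case
      using right_generator_linear[OF M, of x y]
      by (auto simp: op_cat_simps leech_simps mod_cat_simps right_canonical_simps(1))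
  next
    case (3 x)
    then have x: "x \<in> carrier X" by (simp add: op_cat_simps leech_simps)
    show ?case
      using M.ract_one[OF x]
      by (auto simp: op_cat_simps leech_simps mod_cat_simps right_canonical_simps KX_simps
          intro!: restrict_ext)
  next
    case (4 w z x v y)
    then have x: "x \<in> carrier X" and y: "y \<in> carrier X" and v: "v \<in> carrier X"
      and z: "z = x \<otimes>\<^bsub>X\<^esub> y" and w: "w = x \<otimes>\<^bsub>X\<^esub> y \<otimes>\<^bsub>X\<^esub> v"
      by (auto simp: op_cat_simps leech_simps)
    have "amap ?F w x (y \<otimes>\<^bsub>X\<^esub> v) m = amap ?F z x y (amap ?F w z v m)"
      if m: "m \<in> carrier (rcomp M w)" for m
      using M.ract_assoc[OF x y v m[unfolded w], of "free_gen K v" "free_gen K y"]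
        lin_mapsD(2)[OF right_generator_linear[OF M X.m_closed[OF x y] v] m[unfolded w]] m
      by (simp add: KX_simps gen_closed KX_gmul_gen[OF v y] right_canonical_simps z w
          X.m_comm[OF v y])
    moreover have "amap ?F w x (y \<otimes>\<^bsub>X\<^esub> v) \<in> extensional (carrier (rcomp M w))"
      by (simp add: right_canonical_simps)
    ultimately show ?case
      by (auto simp: op_cat_simps leech_simps mod_cat_simps right_canonical_simps(1) compose_def
          intro!: extensionalityI[of _ "carrier (rcomp M w)"])
  qed
qed

text \<open>
  As for left modules, except that the arrow \<open>y\<close> now leads from degree \<open>x + y\<close> to degree \<open>x\<close>.
\<close>

lemma rmod_maps_eq_nat_trans:
  assumes M: "right_module X K (KX X K) M" and M': "right_module X K (KX X K) M'"
  shows "rmod_maps X K (KX X K) M M' = nat_trans (op_cat (leech X)) (mod_cat K)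
    (omap (right_canonical X K) M) (omap (right_canonical X K) M')"
proof -
  interpret M: right_module X K "KX X K" M by (fact M)
  interpret M': right_module X K "KX X K" M' by (fact M')
  let ?F = "omap (right_canonical X K) M" and ?F' = "omap (right_canonical X K) M'"
  have "(\<forall>m\<in>carrier (rcomp M (x \<otimes>\<^bsub>X\<^esub> y)). \<forall>a\<in>carrier (free_module K {y}).
        f x (ract M x y (tens K (rcomp M (x \<otimes>\<^bsub>X\<^esub> y)) (free_module K {y}) m a))
        = ract M' x y (tens K (rcomp M' (x \<otimes>\<^bsub>X\<^esub> y)) (free_module K {y}) (f (x \<otimes>\<^bsub>X\<^esub> y) m) a))
      \<longleftrightarrow> compose (carrier (rcomp M (x \<otimes>\<^bsub>X\<^esub> y))) (f x) (amap ?F (x \<otimes>\<^bsub>X\<^esub> y) x y)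
        = compose (carrier (rcomp M (x \<otimes>\<^bsub>X\<^esub> y))) (amap ?F' (x \<otimes>\<^bsub>X\<^esub> y) x y) (f (x \<otimes>\<^bsub>X\<^esub> y))"
    (is "?L \<longleftrightarrow> ?R")
    if x: "x \<in> carrier X" and y: "y \<in> carrier X"
      and f: "f \<in> (\<Pi>\<^sub>E x\<in>carrier X. lin_maps K (rcomp M x) (rcomp M' x))" for x y f
  proof -
    have fx: "f x \<in> lin_maps K (rcomp M x) (rcomp M' x)"
      and fxy: "f (x \<otimes>\<^bsub>X\<^esub> y) \<in> lin_maps K (rcomp M (x \<otimes>\<^bsub>X\<^esub> y)) (rcomp M' (x \<otimes>\<^bsub>X\<^esub> y))"
      using f x y by auto
    have pointwise: "?R \<longleftrightarrow> (\<forall>m\<in>carrier (rcomp M (x \<otimes>\<^bsub>X\<^esub> y)).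
        f x (amap ?F (x \<otimes>\<^bsub>X\<^esub> y) x y m) = amap ?F' (x \<otimes>\<^bsub>X\<^esub> y) x y (f (x \<otimes>\<^bsub>X\<^esub> y) m))"
    proof (intro iffI ballI)
      fix m assume ?R and "m \<in> carrier (rcomp M (x \<otimes>\<^bsub>X\<^esub> y))"
      from fun_cong[OF this(1), of m] this(2)
      show "f x (amap ?F (x \<otimes>\<^bsub>X\<^esub> y) x y m) = amap ?F' (x \<otimes>\<^bsub>X\<^esub> y) x y (f (x \<otimes>\<^bsub>X\<^esub> y) m)"
        by (simp only: compose_eq)
    qed (simp add: compose_def cong: restrict_cong)
    show ?thesis
      unfolding pointwise
    proof (intro iffI ballI)
      fix m assume L: ?L and m: "m \<in> carrier (rcomp M (x \<otimes>\<^bsub>X\<^esub> y))"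
      have "f x (ract M x y (tens K (rcomp M (x \<otimes>\<^bsub>X\<^esub> y)) (free_module K {y}) m (free_gen K y)))
        = ract M' x y (tens K (rcomp M' (x \<otimes>\<^bsub>X\<^esub> y)) (free_module K {y}) (f (x \<otimes>\<^bsub>X\<^esub> y) m)
            (free_gen K y))"
        by (rule L[rule_format, OF m gen_closed])
      then show "f x (amap ?F (x \<otimes>\<^bsub>X\<^esub> y) x y m) = amap ?F' (x \<otimes>\<^bsub>X\<^esub> y) x y (f (x \<otimes>\<^bsub>X\<^esub> y) m)"
        using m lin_mapsD(2)[OF fxy m] by (simp add: right_canonical_simps)
    next
      fix m a
      assume R: "\<forall>m\<in>carrier (rcomp M (x \<otimes>\<^bsub>X\<^esub> y)).
          f x (amap ?F (x \<otimes>\<^bsub>X\<^esub> y) x y m) = amap ?F' (x \<otimes>\<^bsub>X\<^esub> y) x y (f (x \<otimes>\<^bsub>X\<^esub> y) m)"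
        and m: "m \<in> carrier (rcomp M (x \<otimes>\<^bsub>X\<^esub> y))" and a: "a \<in> carrier (free_module K {y})"
      show "f x (ract M x y (tens K (rcomp M (x \<otimes>\<^bsub>X\<^esub> y)) (free_module K {y}) m a))
        = ract M' x y (tens K (rcomp M' (x \<otimes>\<^bsub>X\<^esub> y)) (free_module K {y}) (f (x \<otimes>\<^bsub>X\<^esub> y) m) a)"
        unfolding right_action_by_generator[OF M x y m a]
          right_action_by_generator[OF M' x y lin_mapsD(2)[OF fxy m] a]
          lin_mapsD(4)[OF fx K.free_module_singleton(1)[OF a]
            lin_mapsD(2)[OF right_generator_linear[OF M x y] m]]
        using R m by simp
    qed
  qed
  note equivariant_iff = this
  show ?thesis
  proof (rule Set.set_eqI)
    fix f
    let ?P = "f \<in> (\<Pi>\<^sub>E x\<in>carrier X. lin_maps K (rcomp M x) (rcomp M' x))"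
    have "f \<in> nat_trans (op_cat (leech X)) (mod_cat K) ?F ?F' \<longleftrightarrow> ?P \<and>
        (\<forall>x\<in>carrier X. \<forall>y\<in>carrier X.
          compose (carrier (rcomp M (x \<otimes>\<^bsub>X\<^esub> y))) (f x) (amap ?F (x \<otimes>\<^bsub>X\<^esub> y) x y)
          = compose (carrier (rcomp M (x \<otimes>\<^bsub>X\<^esub> y))) (amap ?F' (x \<otimes>\<^bsub>X\<^esub> y) x y) (f (x \<otimes>\<^bsub>X\<^esub> y)))"
      unfolding nat_trans_def op_cat_simps leech_simps mod_cat_simps right_canonical_simps(1)
      using X.m_closed by blast
    also have "\<dots> \<longleftrightarrow> f \<in> rmod_maps X K (KX X K) M M'"
      unfolding rmod_maps_def KX_simps mem_Collect_eq using equivariant_iff[of _ _ f]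
      by (intro conj_cong refl ball_cong) (simp only:)
    finally show "f \<in> rmod_maps X K (KX X K) M M'
        \<longleftrightarrow> f \<in> nat_trans (op_cat (leech X)) (mod_cat K) ?F ?F'" ..
  qed
qed

text \<open>
  The structure maps are \<open>m \<otimes> a \<mapsto> a(y) \<cdot> T(y)(m)\<close>. Associativity here also uses that \<open>K\<close> is commutative,
  because the two scalars are extracted in the order opposite to that of the product in the algebra.
\<close>

lemma functor_to_right_module:
  fixes T :: "('x, 'x, ('k, 'v) module, 'v \<Rightarrow> 'v) cfunctor"
  assumes T: "cat_functor (op_cat (leech X)) (mod_cat K) T"
  obtains M where "right_module X K (KX X K) M"
    and "isomorphic_in (functor_cat (op_cat (leech X)) (mod_cat K)) (omap (right_canonical X K) M) T"
proof -
  interpret T: cat_functor "op_cat (leech X)" "mod_cat K" T by (fact T)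
  have T_module: "module K (omap T x)" if "x \<in> carrier X" for x
    using T.omap_closed[of x] that by (simp add: op_cat_simps leech_simps mod_cat_simps)
  have T_linear: "amap T (x \<otimes>\<^bsub>X\<^esub> y) x y \<in> lin_maps K (omap T (x \<otimes>\<^bsub>X\<^esub> y)) (omap T x)"
    if "x \<in> carrier X" "y \<in> carrier X" for x y
    using T.amap_closed[of "x \<otimes>\<^bsub>X\<^esub> y" x y] that
    by (simp add: op_cat_simps leech_simps mod_cat_simps)
  \<comment> \<open>Elements of the tensor product are cosets, so the map is chosen by its values on elementary tensors.\<close>
  define is_act where "is_act x y h \<longleftrightarrow>
      h \<in> lin_maps K (tensor K (omap T (x \<otimes>\<^bsub>X\<^esub> y)) (free_module K {y})) (omap T x) \<and>
      (\<forall>m\<in>carrier (omap T (x \<otimes>\<^bsub>X\<^esub> y)). \<forall>a\<in>carrier (free_module K {y}).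
        h (tens K (omap T (x \<otimes>\<^bsub>X\<^esub> y)) (free_module K {y}) m a)
        = a y \<odot>\<^bsub>omap T x\<^esub> amap T (x \<otimes>\<^bsub>X\<^esub> y) x y m)" for x y h
  define act where "act x y = (SOME h. is_act x y h)" for x y
  have act: "is_act x y (act x y)" if x: "x \<in> carrier X" and y: "y \<in> carrier X" for x y
  proof -
    have "\<exists>h. is_act x y h"
      by (rule K.tensor_free_right_lift[OF T_module[OF X.m_closed[OF x y]] T_module[OF x]
            T_linear[OF x y], of y]) (auto simp: is_act_def)
    then show ?thesis
      unfolding act_def by (rule someI_ex)
  qed
  then have act_tens: "act x y (tens K (omap T (x \<otimes>\<^bsub>X\<^esub> y)) (free_module K {y}) m a)
      = a y \<odot>\<^bsub>omap T x\<^esub> amap T (x \<otimes>\<^bsub>X\<^esub> y) x y m"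
    if "x \<in> carrier X" "y \<in> carrier X" "m \<in> carrier (omap T (x \<otimes>\<^bsub>X\<^esub> y))"
      "a \<in> carrier (free_module K {y})" for x y m a
    using that by (simp add: is_act_def)
  let ?M = "\<lparr>rcomp = omap T, ract = act\<rparr>"
  have M: "right_module X K (KX X K) ?M"
  proof (intro right_module.intro graded_algebra_KX right_module_axioms.intro;
      unfold KX_simps rmod.simps)
    fix x m assume x: "x \<in> carrier X" and m: "m \<in> carrier (omap T x)"
    interpret Tx: module K "omap T x" by (rule T_module[OF x])
    show "act x \<one>\<^bsub>X\<^esub> (tens K (omap T x) (free_module K {\<one>\<^bsub>X\<^esub>}) m (free_gen K \<one>\<^bsub>X\<^esub>)) = m"
      using T.amap_ide[of x] act_tens[OF x X.one_closed, of m "free_gen K \<one>\<^bsub>X\<^esub>"] x m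
      by (simp add: gen_closed gen_at op_cat_simps leech_simps mod_cat_simps)
  next
    fix x y z m a b
    let ?w = "x \<otimes>\<^bsub>X\<^esub> y \<otimes>\<^bsub>X\<^esub> z"
    assume x: "x \<in> carrier X" and y: "y \<in> carrier X" and z: "z \<in> carrier X"
      and m: "m \<in> carrier (omap T ?w)"
      and a: "a \<in> carrier (free_module K {z})" and b: "b \<in> carrier (free_module K {y})"
    note xy = X.m_closed[OF x y] and zy = X.m_closed[OF z y]
    have yz: "y \<otimes>\<^bsub>X\<^esub> z = z \<otimes>\<^bsub>X\<^esub> y" and assoc: "x \<otimes>\<^bsub>X\<^esub> (z \<otimes>\<^bsub>X\<^esub> y) = ?w"
      using x y z by (simp_all add: X.m_ac)
    interpret Tx: module K "omap T x" by (rule T_module[OF x])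
    interpret Txy: module K "omap T (x \<otimes>\<^bsub>X\<^esub> y)" by (rule T_module[OF xy])
    note Tz_m = lin_mapsD(2)[OF T_linear[OF xy z] m]
    note T_y = lin_mapsD[OF T_linear[OF x y]]
    note coeff = K.free_module_singleton(1)[OF a] K.free_module_singleton(1)[OF b]
    have "amap T ?w x (z \<otimes>\<^bsub>X\<^esub> y) = compose (carrier (omap T ?w))
        (amap T (x \<otimes>\<^bsub>X\<^esub> y) x y) (amap T ?w (x \<otimes>\<^bsub>X\<^esub> y) z)"
      using T.amap_cmp[of ?w "x \<otimes>\<^bsub>X\<^esub> y" x z y] x y z
      by (simp add: op_cat_simps leech_simps mod_cat_simps yz)
    then have T_zy: "amap T ?w x (z \<otimes>\<^bsub>X\<^esub> y) m
        = amap T (x \<otimes>\<^bsub>X\<^esub> y) x y (amap T ?w (x \<otimes>\<^bsub>X\<^esub> y) z m)"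
      using m by (simp add: compose_eq)
    have "act x y (tens K (omap T (x \<otimes>\<^bsub>X\<^esub> y)) (free_module K {y})
          (act (x \<otimes>\<^bsub>X\<^esub> y) z (tens K (omap T ?w) (free_module K {z}) m a)) b)
      = b y \<odot>\<^bsub>omap T x\<^esub> (a z \<odot>\<^bsub>omap T x\<^esub>
          amap T (x \<otimes>\<^bsub>X\<^esub> y) x y (amap T ?w (x \<otimes>\<^bsub>X\<^esub> y) z m))"
      using Tz_m coeff by (simp add: act_tens x y z a b m T_y)
    also have "\<dots> = (b y \<otimes>\<^bsub>K\<^esub> a z) \<odot>\<^bsub>omap T x\<^esub> amap T ?w x (z \<otimes>\<^bsub>X\<^esub> y) m"
      using Tz_m coeff by (simp add: T_zy T_y Tx.smult_assoc1)
    also have "b y \<otimes>\<^bsub>K\<^esub> a z = a z \<otimes>\<^bsub>K\<^esub> b y"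
      using coeff by (simp add: K.m_comm)
    also have "(a z \<otimes>\<^bsub>K\<^esub> b y) \<odot>\<^bsub>omap T x\<^esub> amap T ?w x (z \<otimes>\<^bsub>X\<^esub> y) m
      = act x (z \<otimes>\<^bsub>X\<^esub> y) (tens K (omap T ?w) (free_module K {z \<otimes>\<^bsub>X\<^esub> y}) m
          (gmul (KX X K) z y (tens K (free_module K {z}) (free_module K {y}) a b)))"
      using act_tens[OF x zy _ KX_gmul_closed[OF z y a b], unfolded assoc, OF m]
      unfolding KX_gmul_coefficient[OF z y a b] ..
    finally show "act x y (tens K (omap T (x \<otimes>\<^bsub>X\<^esub> y)) (free_module K {y})
          (act (x \<otimes>\<^bsub>X\<^esub> y) z (tens K (omap T ?w) (free_module K {z}) m a)) b)
      = act x (y \<otimes>\<^bsub>X\<^esub> z) (tens K (omap T ?w) (free_module K {y \<otimes>\<^bsub>X\<^esub> z}) m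
          (gmul (KX X K) z y (tens K (free_module K {z}) (free_module K {y}) a b)))"
      unfolding yz .
  qed (use T_module act in \<open>auto simp: is_act_def\<close>)
  have "isomorphic_in (functor_cat (op_cat (leech X)) (mod_cat K)) (omap (right_canonical X K) ?M) T"
  proof (rule isomorphic_in_functor_cat[OF right_canonical_functor[OF M] T])
    fix z x y
    assume "z \<in> obj (op_cat (leech X))" "x \<in> obj (op_cat (leech X))" "y \<in> arr (op_cat (leech X)) z x"
    then have x: "x \<in> carrier X" and y: "y \<in> carrier X" and z: "z = x \<otimes>\<^bsub>X\<^esub> y"
      by (auto simp: op_cat_simps leech_simps)
    interpret Tx: module K "omap T x" by (rule T_module[OF x])
    have "amap (omap (right_canonical X K) ?M) z x y m = amap T z x y m"
      if "m \<in> carrier (omap T z)" for m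
      using that x y lin_mapsD(2)[OF T_linear[OF x y] that[unfolded z]]
      by (simp add: right_canonical_simps act_tens gen_closed gen_at z)
    then show "amap (omap (right_canonical X K) ?M) z x y = amap T z x y"
      using lin_mapsD(1)[OF T_linear[OF x y]] unfolding z
      by (intro extensionalityI[of _ "carrier (omap T (x \<otimes>\<^bsub>X\<^esub> y))"])
        (auto simp: right_canonical_simps PiE_iff)
  qed (simp add: right_canonical_simps)
  with M show thesis by (rule that)
qed

lemma right_canonical_equivalence:
  "equivalence_of_categories (rmod_cat X K (KX X K))
    (functor_cat (op_cat (leech X)) (mod_cat K :: (('k, 'v) module, 'v \<Rightarrow> 'v) cat))
    (right_canonical X K)"
proof -
  have "equivalence_of_categories (rmod_cat X K (KX X K))
    (functor_cat (op_cat (leech X)) (mod_cat K :: (('k, 'v) module, 'v \<Rightarrow> 'v) cat))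
    \<lparr>omap = omap (right_canonical X K), amap = (\<lambda>M M' f. f)\<rparr>"
  proof (rule equivalence_by_hom_identification)
    show "category (functor_cat (op_cat (leech X)) (mod_cat K :: (('k, 'v) module, 'v \<Rightarrow> 'v) cat))"
      by (rule category_functor_cat[OF category_op_cat[OF category_leech] category_mod_cat])
  next
    fix T :: "('x, 'x, ('k, 'v) module, 'v \<Rightarrow> 'v) cfunctor"
    assume "T \<in> obj (functor_cat (op_cat (leech X)) (mod_cat K))"
    then show "\<exists>M\<in>obj (rmod_cat X K (KX X K)).
        isomorphic_in (functor_cat (op_cat (leech X)) (mod_cat K)) (omap (right_canonical X K) M) T"
      by (auto simp: functor_cat_simps rmod_cat_def elim: functor_to_right_module)
  qed (auto simp: rmod_cat_def functor_cat_simps op_cat_simps leech_simps mod_cat_simps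
      right_canonical_simps(1) right_canonical_functor rmod_maps_eq_nat_trans)
  then show ?thesis
    by (simp add: right_canonical_def)
qed

end


section \<open>The two equivalences\<close>

theorem lemma5p1:
  fixes X :: "('x, 's) monoid_scheme" and K :: "('k, 'r) ring_scheme"
  assumes "comm_monoid X" and "cring K"
  shows "equivalence_of_categories
      (lmod_cat X K (KX X K))
      (functor_cat (leech X) (mod_cat K :: (('k, 'v) module, 'v \<Rightarrow> 'v) cat))
      (left_canonical X K)
    \<and> equivalence_of_categories
      (rmod_cat X K (KX X K))
      (functor_cat (op_cat (leech X)) (mod_cat K :: (('k, 'v) module, 'v \<Rightarrow> 'v) cat))
      (right_canonical X K)"
  using left_canonical_equivalence[OF assms] right_canonical_equivalence[OF assms] by (rule conjI)

end
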